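(* Let $G$ be a character on $\mathbf{k}\langle\mathbf{a},\mathbf{b}\rangle$ and let $\widetilde g$ be the associated chain map of the second kind. Then for all $\mathbf{ab}$-polynomials $u,v\in\mathbf{k}\langle\mathbf{a},\mathbf{b}\rangle$, $$\widetilde g(M(u,v))=M(\widetilde g(u),\widetilde g(v)).$$ Equivalently, for all quasisymmetric functions $f_1,f_2\in\mathrm{QSym}$, $$\widetilde g(f_1\cdot f_2)=\widetilde g(f_1)\cdot\widetilde g(f_2).$$
   Context: Let $\mathbf{k}$ be a field and $\mathbf{k}\langle\mathbf{a},\mathbf{b}\rangle$ the algebra of polynomials in noncommuting variables $\mathbf{a},\mathbf{b}$ of degree $1$. For a finite graded poset $P$ (with $\widehat 0$, $\widehat 1$, rank function $\rho$, $\rho(x,y)=\rho(y)-\rho(x)$) of rank at least $1$, the $\mathbf{ab}$-index is $\Psi(P)=\sum_c (\mathbf{a}-\mathbf{b})^{\rho(x_0,x_1)-1}\cdot\mathbf{b}\cdot(\mathbf{a}-\mathbf{b})^{\rho(x_1,x_2)-1}\cdot\mathbf{b}\cdots\mathbf{b}\cdot(\mathbf{a}-\mathbf{b})^{\rho(x_{k-1},x_k)-1}$, summed over all chains $c=\{\widehat 0=x_0<\cdots<x_k=\widehat 1\}$. The $\mathbf{ab}$-indices of such posets span all $\mathbf{ab}$-polynomials, and by a known theorem there is a (unique) bilinear operator $M$ such that $\Psi(P\times Q)=M(\Psi(P),\Psi(Q))$ for all graded posets $P,Q$ of rank at least $1$, where $P\times Q$ is the Cartesian product. A character $G$ on $\mathbf{k}\langle\mathbf{a},\mathbf{b}\rangle$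 is a linear functional $G:\mathbf{k}\langle\mathbf{a},\mathbf{b}\rangle\to\mathbf{k}$ with $G(\Psi(P\times Q))=G(\Psi(P))\cdot G(\Psi(Q))$ for all graded posets $P,Q$ of rank at least $1$. Coproduct: for a monomial $u_1\cdots u_n$, $\Delta(u_1\cdots u_n)=\sum_{i=1}^n u_1\cdots u_{i-1}\otimes u_{i+1}\cdots u_n$ (so $\Delta(1)=0$), extended linearly; it is coassociative. $\Delta^1=\mathrm{id}$, $\Delta^{k+1}=(\mathrm{id}\otimes\Delta^k)\circ\Delta$, with Sweedler notation $\Delta^k(u)=\sum_u u_{(1)}\otimes\cdots\otimes u_{(k)}$. For homogeneous $u$ let $\widehat g(u)=G(u)(\mathbf{a}-\mathbf{b})^{\deg u}$, extended linearly. The chain map of the second kind is $\widetilde g(u)=\sum_{k\ge1}\sum_u\widehat g(u_{(1)})\cdot\mathbf{b}\cdot\widehat g(u_{(2)})\cdot\mathbf{b}\cdots\mathbf{b}\cdot\widehat g(u_{(k)})$ (coproduct into $k$ parts). $\mathrm{QSym}$ is the algebra (over $\mathbf{k}$) of quasisymmetric functions in $t_1,t_2,\ldots$, with linear basis $M_{(p_1,\ldots,p_k)}=\sum_{i_1<\cdots<i_k}t_{i_1}^{p_1}\cdots t_{i_k}^{p_k}$ (all $p_i\ge1$, $k\ge 0$; the empty one is $1_{\mathrm{QSym}}$). The linear map $\gamma((\mathbf{a}-\mathbf{b})^{p_1-1}\cdot\mathbf{b}\cdots\mathbf{b}\cdot(\mathbf{a}-\mathbf{b})^{p_k-1})=M_{(p_1,\ldots,p_k)}$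 is an isomorphism of $\mathbf{k}\langle\mathbf{a},\mathbf{b}\rangle$ onto quasisymmetric functions with no constant term. On $\mathrm{QSym}$, $\widetilde g$ denotes the linear map with $\widetilde g(1_{\mathrm{QSym}})=1_{\mathrm{QSym}}$ and $\widetilde g(f)=\gamma(\widetilde g(\gamma^{-1}(f)))$ for $f$ with no constant term. *)

theory Defs
  imports Complex_Main "HOL-Library.Poly_Mapping"
begin

section \<open>The algebra of polynomials in two noncommuting variables\<close>

text \<open>
  Words under concatenation form the free monoid. It is written additively because
  multiplication on \<open>_ \<Rightarrow>\<^sub>0 _\<close> is convolution over an additive monoid of exponents.
\<close>

instantiation list :: (type) monoid_add
begin

definition zero_list :: "'a list" where "zero_list = []"
definition plus_list :: "'a list \<Rightarrow> 'a list \<Rightarrow> 'a list" where "plus_list = (@)"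

instance
  by standard (simp_all add: zero_list_def plus_list_def)

end

datatype letter = LA | LB

type_synonym 'k ab_poly = "letter list \<Rightarrow>\<^sub>0 'k"

abbreviation va :: "'k::field ab_poly" where "va \<equiv> Poly_Mapping.single [LA] 1"
abbreviation vb :: "'k::field ab_poly" where "vb \<equiv> Poly_Mapping.single [LB] 1"

definition pm_scale :: "'k::field \<Rightarrow> ('a \<Rightarrow>\<^sub>0 'k) \<Rightarrow> ('a \<Rightarrow>\<^sub>0 'k)" where
  "pm_scale c = Poly_Mapping.map ((*) c)"

lemma lookup_pm_scale [simp]: "Poly_Mapping.lookup (pm_scale c p) x = c * Poly_Mapping.lookup p x"
  by (simp add: pm_scale_def Poly_Mapping.map.rep_eq when_def)

lemma vector_space_pm_scale: "vector_space pm_scale"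
  by unfold_locales (rule poly_mapping_eqI, simp add: lookup_add algebra_simps)+

lemma vector_space_field: "vector_space ((*) :: 'k::field \<Rightarrow> 'k \<Rightarrow> 'k)"
  by unfold_locales (simp_all add: algebra_simps)

definition lin_ext :: "('a \<Rightarrow> ('b \<Rightarrow>\<^sub>0 'k)) \<Rightarrow> ('a \<Rightarrow>\<^sub>0 'k::field) \<Rightarrow> ('b \<Rightarrow>\<^sub>0 'k)" where
  "lin_ext f p = (\<Sum>x\<in>Poly_Mapping.keys p. pm_scale (Poly_Mapping.lookup p x) (f x))"

text \<open>\<open>join_b [u\<^sub>1, \<dots>, u\<^sub>k] = u\<^sub>1 * vb * u\<^sub>2 * vb * \<dots> * vb * u\<^sub>k\<close>; only used for \<open>k \<ge> 1\<close>.\<close>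

fun join_b :: "'k::field ab_poly list \<Rightarrow> 'k ab_poly" where
  "join_b [] = 1"
| "join_b [u] = u"
| "join_b (u # v # us) = u * vb * join_b (v # us)"

definition comp_poly :: "nat list \<Rightarrow> 'k::field ab_poly" where
  "comp_poly ps = join_b (map (\<lambda>p. (va - vb) ^ (p - 1)) ps)"


section \<open>Graded posets and the ab-index\<close>

text \<open>
  A poset is represented by its (reflexive) order relation \<open>r\<close>; the elements are \<open>Field r\<close>.
\<close>

definition bottom :: "'p rel \<Rightarrow> 'p" where
  "bottom r = (THE x. x \<in> Field r \<and> (\<forall>y\<in>Field r. (x, y) \<in> r))"

definition topmost :: "'p rel \<Rightarrow> 'p" where
  "topmost r = (THE x. x \<in> Field r \<and> (\<forall>y\<in>Field r. (y, x) \<in> r))"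

definition covered :: "'p rel \<Rightarrow> 'p \<Rightarrow> 'p \<Rightarrow> bool" where
  "covered r x y \<longleftrightarrow> (x, y) \<in> r - Id \<and> \<not> (\<exists>z. (x, z) \<in> r - Id \<and> (z, y) \<in> r - Id)"

definition rank_function :: "'p rel \<Rightarrow> ('p \<Rightarrow> nat) \<Rightarrow> bool" where
  "rank_function r \<rho> \<longleftrightarrow> \<rho> (bottom r) = 0 \<and> (\<forall>x y. covered r x y \<longrightarrow> \<rho> y = \<rho> x + 1)"

definition graded_poset :: "'p rel \<Rightarrow> bool" where
  "graded_poset r \<longleftrightarrow> Partial_order r \<and> finite (Field r)
     \<and> (\<exists>x\<in>Field r. \<forall>y\<in>Field r. (x, y) \<in> r)
     \<and> (\<exists>x\<in>Field r. \<forall>y\<in>Field r. (y, x) \<in> r)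
     \<and> (\<exists>\<rho>. rank_function r \<rho>)"

text \<open>On \<open>Field r\<close> the rank function of a graded poset is unique, so the choice is immaterial.\<close>

definition poset_rank :: "'p rel \<Rightarrow> 'p \<Rightarrow> nat" where
  "poset_rank r = (SOME \<rho>. rank_function r \<rho>)"

definition graded_poset_pos :: "'p rel \<Rightarrow> bool" where
  "graded_poset_pos r \<longleftrightarrow> graded_poset r \<and> poset_rank r (topmost r) \<ge> 1"

definition poset_prod :: "'p rel \<Rightarrow> 'q rel \<Rightarrow> ('p \<times> 'q) rel" where
  "poset_prod r s = {((x, y), (x', y')). (x, x') \<in> r \<and> (y, y') \<in> s}"

text \<open>Chains \<open>x\<^sub>0 < \<dots> < x\<^sub>k\<close> from bottom to top, listed in increasing order.\<close>

definition full_chains :: "'p rel \<Rightarrow> 'p list set" where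
  "full_chains r = {xs. xs \<noteq> [] \<and> set xs \<subseteq> Field r \<and> sorted_wrt (\<lambda>x y. (x, y) \<in> r - Id) xs
     \<and> hd xs = bottom r \<and> last xs = topmost r}"

definition ab_index :: "'p rel \<Rightarrow> 'k::field ab_poly" where
  "ab_index r = (\<Sum>xs\<in>full_chains r. comp_poly (map2 (\<lambda>x y. poset_rank r y - poset_rank r x) xs (tl xs)))"

text \<open>
  The next two definitions quantify over all finite graded posets. Since the ab-index is
  invariant under isomorphism and every finite poset has a copy on a finite set of natural
  numbers, it suffices to let the posets range over relations on \<^typ>\<open>nat\<close>.

  \<open>mix\<close> is the operator \<open>M\<close>. It is unique because ab-indices of graded posets of rank at least 1
  span, and it exists because \<open>ab_index (poset_prod r s)\<close> depends bilinearly on the ab-indices.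
\<close>

definition mix :: "'k::field ab_poly \<Rightarrow> 'k ab_poly \<Rightarrow> 'k ab_poly" where
  "mix = (THE M.
      (\<forall>u. Vector_Spaces.linear pm_scale pm_scale (M u))
    \<and> (\<forall>v. Vector_Spaces.linear pm_scale pm_scale (\<lambda>u. M u v))
    \<and> (\<forall>(r :: nat rel) (s :: nat rel). graded_poset_pos r \<longrightarrow> graded_poset_pos s \<longrightarrow>
         ab_index (poset_prod r s) = M (ab_index r) (ab_index s)))"

definition ab_character :: "('k::field ab_poly \<Rightarrow> 'k) \<Rightarrow> bool" where
  "ab_character G \<longleftrightarrow> Vector_Spaces.linear pm_scale (*) G
    \<and> (\<forall>(r :: nat rel) (s :: nat rel). graded_poset_pos r \<longrightarrow> graded_poset_pos s \<longrightarrow>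
         G (ab_index (poset_prod r s)) = G (ab_index r) * G (ab_index s))"


section \<open>Coproduct and chain map of the second kind\<close>

text \<open>
  The tensor square of the ab-polynomials has the pairs of words as basis, and the \<open>k\<close>-th tensor
  power has the lists of \<open>k\<close> words as basis.
\<close>

definition coprod :: "'k::field ab_poly \<Rightarrow> (letter list \<times> letter list) \<Rightarrow>\<^sub>0 'k" where
  "coprod = lin_ext (\<lambda>w. \<Sum>i<length w. Poly_Mapping.single (take i w, drop (Suc i) w) 1)"

definition tensor_cons :: "letter list \<Rightarrow> (letter list list \<Rightarrow>\<^sub>0 'k::field) \<Rightarrow> (letter list list \<Rightarrow>\<^sub>0 'k)" where
  "tensor_cons w = lin_ext (\<lambda>ws. Poly_Mapping.single (w # ws) 1)"

text \<open>
  \<open>coprod_into k\<close> is \<open>\<Delta>\<^sup>k\<close>, the coproduct into \<open>k\<close> parts, for \<open>k \<ge> 1\<close>; the value at \<open>k = 0\<close> is a dummy.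
  The last equation is \<open>\<Delta>\<^sup>k\<^sup>+\<^sup>2 = (id \<otimes> \<Delta>\<^sup>k\<^sup>+\<^sup>1) \<circ> \<Delta>\<close>.
\<close>

fun coprod_into :: "nat \<Rightarrow> 'k::field ab_poly \<Rightarrow> (letter list list \<Rightarrow>\<^sub>0 'k)" where
  "coprod_into 0 u = 0"
| "coprod_into (Suc 0) u = lin_ext (\<lambda>w. Poly_Mapping.single [w] 1) u"
| "coprod_into (Suc (Suc k)) u =
     lin_ext (\<lambda>(w, w'). tensor_cons w (coprod_into (Suc k) (Poly_Mapping.single w' 1))) (coprod u)"

text \<open>Monomials are homogeneous and span, so it suffices to prescribe \<open>ghat\<close> on them.\<close>

definition ghat :: "('k::field ab_poly \<Rightarrow> 'k) \<Rightarrow> 'k ab_poly \<Rightarrow> 'k ab_poly" where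
  "ghat G = lin_ext (\<lambda>w. pm_scale (G (Poly_Mapping.single w 1)) ((va - vb) ^ length w))"

text \<open>
  The sum over \<open>k \<ge> 1\<close> has finite support, as \<open>coprod_into k u = 0\<close> once \<open>k\<close> exceeds the degree
  of \<open>u\<close> by more than 1.
\<close>

definition gtilde :: "('k::field ab_poly \<Rightarrow> 'k) \<Rightarrow> 'k ab_poly \<Rightarrow> 'k ab_poly" where
  "gtilde G u = Sum_any (\<lambda>k. if k \<ge> 1
     then lin_ext (\<lambda>ws. join_b (map (\<lambda>w. ghat G (Poly_Mapping.single w 1)) ws)) (coprod_into k u)
     else 0)"


section \<open>Quasisymmetric functions\<close>

text \<open>
  Formal power series in countably many commuting variables; the variable \<open>t\<^sub>i\<^sub>+\<^sub>1\<close> is indexed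
  by \<open>i :: nat\<close> and a monomial is its finitely supported exponent vector.
\<close>

typedef 'k mfps = "UNIV :: ((nat \<Rightarrow>\<^sub>0 nat) \<Rightarrow> 'k) set"
  morphisms mcoeff Abs_mfps ..

lemma mcoeff_Abs [simp]: "mcoeff (Abs_mfps f) = f"
  by (simp add: Abs_mfps_inverse)

lemma mfps_eqI: "(\<And>m. mcoeff f m = mcoeff g m) \<Longrightarrow> f = g"
  by (metis ext mcoeff_inject)

definition splits :: "(nat \<Rightarrow>\<^sub>0 nat) \<Rightarrow> ((nat \<Rightarrow>\<^sub>0 nat) \<times> (nat \<Rightarrow>\<^sub>0 nat)) set" where
  "splits m = {(i, j). i + j = m}"

lemma finite_splits [simp]: "finite (splits m)"
proof -
  define F where "F = {f :: nat \<Rightarrow> nat. \<forall>x. (x \<in> Poly_Mapping.keys m \<longrightarrow> f x \<in> {..Max (Poly_Mapping.lookup m ` Poly_Mapping.keys m)})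
      \<and> (x \<notin> Poly_Mapping.keys m \<longrightarrow> f x = 0)}"
  have "finite F"
    unfolding F_def by (rule finite_set_of_finite_funs) auto
  then have fin: "finite (Poly_Mapping.lookup -` F)"
    by (rule finite_vimageI) (simp add: inj_def)
  have le: "Poly_Mapping.lookup i \<in> F" if "\<And>x. Poly_Mapping.lookup i x \<le> Poly_Mapping.lookup m x" for i
    unfolding F_def
    by (auto simp: in_keys_iff intro: order.trans[OF that] Max_ge)
       (use that in \<open>metis le_zero_eq\<close>)
  have "splits m \<subseteq> Poly_Mapping.lookup -` F \<times> Poly_Mapping.lookup -` F"
    by (auto simp: splits_def intro!: le simp: lookup_add)
  then show ?thesis
    using fin finite_subset by blast
qed

instantiation mfps :: (comm_ring_1) comm_ring_1
begin

definition zero_mfps :: "'a mfps" where "0 = Abs_mfps (\<lambda>_. 0)"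
definition one_mfps :: "'a mfps" where "1 = Abs_mfps (\<lambda>m. if m = 0 then 1 else 0)"
definition plus_mfps :: "'a mfps \<Rightarrow> 'a mfps \<Rightarrow> 'a mfps" where
  "f + g = Abs_mfps (\<lambda>m. mcoeff f m + mcoeff g m)"
definition uminus_mfps :: "'a mfps \<Rightarrow> 'a mfps" where
  "- f = Abs_mfps (\<lambda>m. - mcoeff f m)"
definition minus_mfps :: "'a mfps \<Rightarrow> 'a mfps \<Rightarrow> 'a mfps" where
  "f - g = Abs_mfps (\<lambda>m. mcoeff f m - mcoeff g m)"
definition times_mfps :: "'a mfps \<Rightarrow> 'a mfps \<Rightarrow> 'a mfps" where
  "f * g = Abs_mfps (\<lambda>m. \<Sum>(i, j)\<in>splits m. mcoeff f i * mcoeff g j)"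

instance
proof
  fix f g h :: "'a mfps"
  show "f * g * h = f * (g * h)"
  proof (rule mfps_eqI)
    fix m
    have "mcoeff (f * g * h) m = (\<Sum>(p, l)\<in>splits m. \<Sum>(i, j)\<in>splits p. mcoeff f i * mcoeff g j * mcoeff h l)"
      by (simp add: times_mfps_def sum_distrib_right case_prod_unfold)
    also have "\<dots> = (\<Sum>((p, l), (i, j))\<in>Sigma (splits m) (\<lambda>(p, l). splits p). mcoeff f i * mcoeff g j * mcoeff h l)"
      by (subst sum.Sigma[symmetric]) (auto simp: case_prod_unfold)
    also have "\<dots> = (\<Sum>((i, q), (j, l))\<in>Sigma (splits m) (\<lambda>(i, q). splits q). mcoeff f i * mcoeff g j * mcoeff h l)"
      by (rule sum.reindex_bij_witness
            [where i = "\<lambda>((i, q), (j, l)). ((i + j, l), (i, j))" and j = "\<lambda>((p, l), (i, j)). ((i, j + l), (j, l))"])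
         (auto simp: splits_def add.assoc)
    also have "\<dots> = (\<Sum>(i, q)\<in>splits m. \<Sum>(j, l)\<in>splits q. mcoeff f i * mcoeff g j * mcoeff h l)"
      by (subst sum.Sigma[symmetric]) (auto simp: case_prod_unfold)
    also have "\<dots> = mcoeff (f * (g * h)) m"
      by (simp add: times_mfps_def sum_distrib_left case_prod_unfold mult.assoc)
    finally show "mcoeff (f * g * h) m = mcoeff (f * (g * h)) m" .
  qed
  show "f * g = g * f"
    by (rule mfps_eqI, simp add: times_mfps_def,
        rule sum.reindex_bij_witness[where i = prod.swap and j = prod.swap])
       (auto simp: splits_def add.commute mult.commute)
  show "1 * f = f"
  proof (rule mfps_eqI)
    fix m
    have "mcoeff (1 * f) m = (\<Sum>(i, j)\<in>splits m. if i = 0 then mcoeff f j else 0)"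
      by (auto simp: times_mfps_def one_mfps_def intro!: sum.cong)
    also have "\<dots> = (\<Sum>(i, j)\<in>{(0 :: nat \<Rightarrow>\<^sub>0 nat, m)}. if i = 0 then mcoeff f j else 0)"
      by (rule sum.mono_neutral_right, simp, simp add: splits_def)
         (auto simp: splits_def split: if_split_asm)
    finally show "mcoeff (1 * f) m = mcoeff f m" by simp
  qed
  show "(f + g) * h = f * h + g * h"
    by (rule mfps_eqI)
       (simp add: times_mfps_def plus_mfps_def sum.distrib[symmetric] case_prod_unfold distrib_right)
  show "(0 :: 'a mfps) \<noteq> 1"
  proof
    assume "(0 :: 'a mfps) = 1"
    then have "mcoeff (0 :: 'a mfps) 0 = mcoeff 1 0" by simp
    then show False by (simp add: zero_mfps_def one_mfps_def)
  qed
qed (rule mfps_eqI, simp add: zero_mfps_def plus_mfps_def uminus_mfps_def minus_mfps_def algebra_simps)+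

end

definition mscale :: "'k::field \<Rightarrow> 'k mfps \<Rightarrow> 'k mfps" where
  "mscale c f = Abs_mfps (\<lambda>m. c * mcoeff f m)"

lemma vector_space_mscale: "vector_space mscale"
  by unfold_locales (rule mfps_eqI, simp add: mscale_def plus_mfps_def algebra_simps)+

text \<open>\<open>expo [i\<^sub>1, \<dots>, i\<^sub>k] [p\<^sub>1, \<dots>, p\<^sub>k]\<close> is the exponent vector with entry \<open>p\<^sub>l\<close> at \<open>i\<^sub>l\<close>.\<close>

definition expo :: "nat list \<Rightarrow> nat list \<Rightarrow> (nat \<Rightarrow>\<^sub>0 nat)" where
  "expo is ps = sum_list (map2 Poly_Mapping.single is ps)"

definition composition :: "nat list \<Rightarrow> bool" where
  "composition ps \<longleftrightarrow> (\<forall>p\<in>set ps. p \<ge> 1)"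

definition QSym :: "'k::field mfps set" where
  "QSym = {f.
      (\<exists>d. \<forall>m. mcoeff f m \<noteq> 0 \<longrightarrow> (\<Sum>i\<in>Poly_Mapping.keys m. Poly_Mapping.lookup m i) \<le> d)
    \<and> (\<forall>ps is js. composition ps \<longrightarrow> length is = length ps \<longrightarrow> length js = length ps \<longrightarrow>
         sorted_wrt (<) is \<longrightarrow> sorted_wrt (<) js \<longrightarrow> mcoeff f (expo is ps) = mcoeff f (expo js ps))}"

text \<open>
  The monomial quasisymmetric function indexed by \<open>ps\<close>. For a composition \<open>ps\<close> distinct
  index lists give distinct monomials, so every coefficient of the defining sum is 0 or 1.
\<close>

definition QM :: "nat list \<Rightarrow> 'k::field mfps" where
  "QM ps = Abs_mfps (\<lambda>m.
     if \<exists>is. length is = length ps \<and> sorted_wrt (<) is \<and> m = expo is ps then 1 else 0)"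

text \<open>
  Well defined because the \<open>comp_poly ps\<close>, for nonempty compositions \<open>ps\<close>, are a basis.
\<close>

definition gam :: "'k::field ab_poly \<Rightarrow> 'k mfps" where
  "gam = (THE \<gamma>. Vector_Spaces.linear pm_scale mscale \<gamma>
     \<and> (\<forall>ps. ps \<noteq> [] \<longrightarrow> composition ps \<longrightarrow> \<gamma> (comp_poly ps) = QM ps))"

text \<open>
  \<open>mcoeff f 0\<close> is the constant term of \<open>f\<close>. The definition is the linear extension, along the
  splitting of \<open>QSym\<close> into constants and functions without constant term, of \<open>1 \<mapsto> 1\<close> and
  \<open>gam \<circ> gtilde G \<circ> inv gam\<close>; it is only meaningful on \<open>QSym\<close>.
\<close>

definition gtilde_QSym :: "('k::field ab_poly \<Rightarrow> 'k) \<Rightarrow> 'k mfps \<Rightarrow> 'k mfps" where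
  "gtilde_QSym G f = mscale (mcoeff f 0) 1 + gam (gtilde G (inv gam (f - mscale (mcoeff f 0) 1)))"

end

theory Submission
  imports Defs
begin

text \<open>
  The polynomials \<^term>\<open>comp_poly p\<close>, for nonempty compositions \<open>p\<close>, form a basis of the
  ab-polynomials, and \<^const>\<open>gam\<close> sends it to the monomial quasisymmetric functions. The proof
  computes the product, the coproduct and the chain map in this basis.

  The product \<open>QM p * QM q\<close> is the sum of the \<open>QM r\<close> with quasi-shuffle coefficients. Let
  \<open>shuffle\<close> be the bilinear product of ab-polynomials with the same coefficients, so that
  \<^const>\<open>gam\<close> is multiplicative for it (\<open>gam_shuffle\<close>). This product is \<^const>\<open>mix\<close>
  (\<open>mix_eq_shuffle\<close>): a multichain in \<open>P \<times> Q\<close> is a pair of multichains in \<open>P\<close> and \<open>Q\<close>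
  whose rank steps add up (\<open>multichains_prod\<close>), and there are enough posets, because ordinal
  sums of antichains with one or two elements have all products of \<open>a\<close> and \<open>a + b\<close> as
  ab-indices (\<open>linear_eq_on_ab_index\<close>). Hence \<open>G\<close> is a character exactly when it is linear and
  multiplicative for \<open>shuffle\<close>.

  The coproduct is a derivation that kills \<open>a - b\<close> and sends \<open>b\<close> to \<open>1 \<otimes> 1\<close>, so it
  deconcatenates the compositions that index the basis (\<open>coprod_comp_poly\<close>). Therefore
  \<open>gtilde G\<close> maps the basis element of \<open>p\<close> to the sum over all ways of cutting \<open>p\<close> into
  consecutive blocks, each weighted by the product of the values of \<open>G\<close> at the blocks, of the basis
  element indexed by the sums of the blocks (\<open>gtilde_comp_poly\<close>).

  Deconcatenation is multiplicative for the quasi-shuffle product (\<open>shuffle_coeff_append\<close>). Cutting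
  off one block at a time, this and the multiplicativity of \<open>G\<close> show that the weights above
  are multiplicative (\<open>block_coeff_shuffle\<close>), which is the first assertion. It is convenient
  to admit empty blocks, of sum 0 and weight 1: the list of block sums then plays the role of the
  exponent vector of a monomial, and exponent vectors simply add under multiplication.

  The second assertion follows because every quasisymmetric function is the sum of a constant and
  some \<open>gam u\<close> (\<open>QSym_decompose\<close>).
\<close>

section \<open>Linear extension\<close>

abbreviation plinear :: "(('a \<Rightarrow>\<^sub>0 'k::field) \<Rightarrow> ('b \<Rightarrow>\<^sub>0 'k)) \<Rightarrow> bool" where
  "plinear \<equiv> Vector_Spaces.linear pm_scale pm_scale"

lemma linear_map_sum:
  assumes "Vector_Spaces.linear s1 s2 f"
  shows "f (\<Sum>x\<in>A. g x) = (\<Sum>x\<in>A. f (g x))"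
  using module_hom.sum[of s1 s2 f g A] assms by (simp add: Vector_Spaces.linear_def)

lemma linear_map_add: "Vector_Spaces.linear s1 s2 f \<Longrightarrow> f (x + y) = f x + f y"
  by (simp add: Vector_Spaces.linear_iff)

lemma linear_map_scale: "Vector_Spaces.linear s1 s2 f \<Longrightarrow> f (s1 c x) = s2 c (f x)"
  by (simp add: Vector_Spaces.linear_iff)

lemma linear_map_diff: "Vector_Spaces.linear s1 s2 f \<Longrightarrow> f (x - y) = f x - f y"
  using module_hom.diff[of s1 s2 f] by (simp add: Vector_Spaces.linear_def)

lemma plinearI:
  assumes "\<And>u v. f (u + v) = f u + f v" and "\<And>c u. f (pm_scale c u) = pm_scale c (f u)"
  shows "plinear f"
  using assms by (simp add: Vector_Spaces.linear_iff vector_space_pm_scale)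

lemma pm_scale_0_left [simp]: "pm_scale 0 u = 0"
  and pm_scale_0_right [simp]: "pm_scale c 0 = 0"
  and pm_scale_1 [simp]: "pm_scale 1 u = u"
  and pm_scale_scale [simp]: "pm_scale c (pm_scale d u) = pm_scale (c * d) u"
  by (rule poly_mapping_eqI, simp)+

lemma pm_scale_add: "pm_scale c (u + v) = pm_scale c u + pm_scale c v"
  and pm_scale_add_left: "pm_scale (c + d) u = pm_scale c u + pm_scale d u"
  by (rule poly_mapping_eqI, simp add: lookup_add algebra_simps)+

lemma pm_scale_single [simp]: "pm_scale c (Poly_Mapping.single x d) = Poly_Mapping.single x (c * d)"
  by (rule poly_mapping_eqI) (simp add: lookup_single when_def)

lemma pm_scale_sum: "pm_scale c (\<Sum>x\<in>A. f x) = (\<Sum>x\<in>A. pm_scale c (f x))"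
  by (induction A rule: infinite_finite_induct) (simp_all add: pm_scale_add)

lemma pm_scale_sum_left: "pm_scale (\<Sum>x\<in>A. c x) u = (\<Sum>x\<in>A. pm_scale (c x) u)"
  by (induction A rule: infinite_finite_induct) (simp_all add: pm_scale_add_left)

lemma poly_mapping_sum_singles: "(\<Sum>x\<in>Poly_Mapping.keys p. Poly_Mapping.single x (Poly_Mapping.lookup p x)) = p"
  by (rule poly_mapping_eqI) (simp add: lookup_sum lookup_single when_def in_keys_iff)

lemma poly_mapping_add_induct [case_names single add]:
  fixes p :: "'a \<Rightarrow>\<^sub>0 'k::comm_monoid_add"
  assumes single: "\<And>x c. P (Poly_Mapping.single x c)" and add: "\<And>p q. P p \<Longrightarrow> P q \<Longrightarrow> P (p + q)"
  shows "P p"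
proof -
  have "P (\<Sum>x\<in>A. Poly_Mapping.single x (c x))" if "finite A" for A c
    using that by induction (use single[of _ 0] assms in simp_all)
  from this[of "Poly_Mapping.keys p" "Poly_Mapping.lookup p"] show ?thesis
    by (simp add: poly_mapping_sum_singles)
qed

text \<open>
  Scalars are the multiples of the empty word, which are central; this lets scalars be moved
  through products.
\<close>

lemma pm_scale_eq_mult: "pm_scale c u = Poly_Mapping.single [] c * (u :: 'k::field ab_poly)"
proof (induction u rule: poly_mapping_add_induct)
  case (single x d)
  then show ?case by (simp add: mult_single plus_list_def)
next
  case (add p q)
  then show ?case by (simp add: pm_scale_add distrib_left)
qed

lemma mult_scalar_commute: "u * Poly_Mapping.single [] c = Poly_Mapping.single [] c * (u :: 'k::field ab_poly)"
proof (induction u rule: poly_mapping_add_induct)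
  case (single x d)
  then show ?case by (simp add: mult_single plus_list_def mult.commute)
next
  case (add p q)
  then show ?case by (simp add: distrib_left distrib_right)
qed

lemma mult_pm_scale_left [simp]: "pm_scale c u * v = pm_scale c (u * v :: 'k::field ab_poly)"
  by (simp add: pm_scale_eq_mult mult.assoc)

lemma mult_pm_scale_right [simp]: "u * pm_scale c v = pm_scale c (u * v :: 'k::field ab_poly)"
proof -
  have "u * (Poly_Mapping.single [] c * v) = (u * Poly_Mapping.single [] c) * v"
    by (simp add: mult.assoc)
  also have "\<dots> = Poly_Mapping.single [] c * (u * v)"
    by (simp only: mult_scalar_commute mult.assoc)
  finally show ?thesis by (simp add: pm_scale_eq_mult)
qed

lemma lin_ext_superset:
  assumes "finite A" "Poly_Mapping.keys p \<subseteq> A"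
  shows "lin_ext f p = (\<Sum>x\<in>A. pm_scale (Poly_Mapping.lookup p x) (f x))"
  unfolding lin_ext_def using assms
  by (intro sum.mono_neutral_left) (auto simp: in_keys_iff)

lemma lin_ext_add: "lin_ext f (p + q) = lin_ext f p + lin_ext f q"
proof -
  let ?A = "Poly_Mapping.keys p \<union> Poly_Mapping.keys q"
  have "Poly_Mapping.keys (p + q) \<subseteq> ?A" by (rule Poly_Mapping.keys_add)
  then show ?thesis
    by (simp add: lin_ext_superset[of ?A] lookup_add pm_scale_add_left sum.distrib)
qed

lemma lin_ext_scale: "lin_ext f (pm_scale c p) = pm_scale c (lin_ext f p)"
proof -
  have "Poly_Mapping.keys (pm_scale c p) \<subseteq> Poly_Mapping.keys p"
    by (auto simp: in_keys_iff)
  then show ?thesis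
    by (simp add: lin_ext_superset[of "Poly_Mapping.keys p"] pm_scale_sum)
qed

lemma linear_lin_ext: "plinear (lin_ext f)"
  by (intro plinearI lin_ext_add lin_ext_scale)

lemma lin_ext_single [simp]: "lin_ext f (Poly_Mapping.single x c) = pm_scale c (f x)"
  by (cases "c = 0") (simp_all add: lin_ext_def)

lemma lin_ext_zero [simp]: "lin_ext f 0 = 0"
  by (simp add: lin_ext_def)

lemma lin_ext_fun_sum: "lin_ext (\<lambda>x. f x + g x) p = lin_ext f p + lin_ext g p"
  by (simp add: lin_ext_def pm_scale_add sum.distrib)

lemma lin_ext_fun_scale: "lin_ext (\<lambda>x. pm_scale c (f x)) p = pm_scale c (lin_ext f p)"
  by (simp add: lin_ext_def pm_scale_sum mult.commute)

lemma linear_of_lin_ext: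
  assumes "Vector_Spaces.linear pm_scale s f"
  shows "f (lin_ext h p) = (\<Sum>x\<in>Poly_Mapping.keys p. s (Poly_Mapping.lookup p x) (f (h x)))"
  by (simp add: lin_ext_def linear_map_sum[OF assms] linear_map_scale[OF assms])

lemma linear_comp_lin_ext:
  "plinear f \<Longrightarrow> f (lin_ext h p) = lin_ext (\<lambda>x. f (h x)) p"
  by (simp add: linear_of_lin_ext[where s = pm_scale] lin_ext_def[of "\<lambda>x. f (h x)"])

lemma lin_ext_cong: "(\<And>x. x \<in> Poly_Mapping.keys p \<Longrightarrow> f x = g x) \<Longrightarrow> lin_ext f p = lin_ext g p"
  by (simp add: lin_ext_def)

lemma lin_ext_id: "lin_ext (\<lambda>x. Poly_Mapping.single x 1) p = p"
  by (simp add: lin_ext_def poly_mapping_sum_singles)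

lemma linear_mult_left: "plinear (\<lambda>u. w * u)" for w :: "'k::field ab_poly"
  by (rule plinearI) (simp_all add: distrib_left)

lemma linear_compose:
  "Vector_Spaces.linear s1 s2 f \<Longrightarrow> Vector_Spaces.linear s2 s3 g \<Longrightarrow> Vector_Spaces.linear s1 s3 (\<lambda>u. g (f u))"
  by (simp add: Vector_Spaces.linear_iff)

lemma linear_eq_on_words:
  assumes "Vector_Spaces.linear pm_scale s f" "Vector_Spaces.linear pm_scale s g"
    and "\<And>w. f (Poly_Mapping.single w 1) = g (Poly_Mapping.single w 1)"
  shows "f u = g u"
  using linear_of_lin_ext[OF assms(1), of "\<lambda>w. Poly_Mapping.single w 1" u]
    linear_of_lin_ext[OF assms(2), of "\<lambda>w. Poly_Mapping.single w 1" u] assms(3)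
  by (simp add: lin_ext_id)


section \<open>The basis of ab-polynomials indexed by compositions\<close>

lemma composition_Nil [simp]: "composition []"
  and composition_Cons [simp]: "composition (n # ps) \<longleftrightarrow> 1 \<le> n \<and> composition ps"
  and composition_append [simp]: "composition (ps @ qs) \<longleftrightarrow> composition ps \<and> composition qs"
  by (auto simp: composition_def)

text \<open>
  Every nonempty composition arises from \<open>[1]\<close> by enlarging the first part and by prepending
  a part 1. On \<^const>\<open>comp_poly\<close> these steps are multiplication by \<open>a - b\<close> and by \<open>b\<close>
  from the left.
\<close>

lemma composition_induct [consumes 2, case_names one grow one_Cons]:
  assumes "composition ps" "ps \<noteq> []"
    and one: "P [1]"
    and grow: "\<And>n qs. 1 \<le> n \<Longrightarrow> composition qs \<Longrightarrow> P (n # qs) \<Longrightarrow> P (Suc n # qs)"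
    and one_Cons: "\<And>qs. qs \<noteq> [] \<Longrightarrow> composition qs \<Longrightarrow> P qs \<Longrightarrow> P (1 # qs)"
  shows "P ps"
  using assms(1,2)
proof (induction ps)
  case (Cons n ps)
  have "P (Suc m # ps)" for m
  proof (induction m)
    case 0
    then show ?case using Cons one one_Cons by (cases "ps = []") auto
  next
    case (Suc m)
    then show ?case using Cons grow by simp
  qed
  then show ?case using Cons.prems by (cases n) auto
qed simp

lemma comp_poly_single: "comp_poly [n] = (va - vb) ^ (n - 1)"
  by (simp add: comp_poly_def)

lemma comp_poly_Cons: "ps \<noteq> [] \<Longrightarrow> comp_poly (n # ps) = (va - vb) ^ (n - 1) * vb * comp_poly ps"
  by (cases ps) (simp_all add: comp_poly_def)

lemma comp_poly_grow: "1 \<le> n \<Longrightarrow> comp_poly (Suc n # ps) = (va - vb) * comp_poly (n # ps)"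
  by (cases n; cases "ps = []") (simp_all add: comp_poly_single comp_poly_Cons mult.assoc)

lemma comp_poly_one: "comp_poly [Suc 0] = 1"
  by (simp add: comp_poly_single)

lemma comp_poly_one_Cons: "ps \<noteq> [] \<Longrightarrow> comp_poly (Suc 0 # ps) = vb * comp_poly ps"
  by (simp add: comp_poly_Cons)

fun grow_head :: "nat list \<Rightarrow> nat list" where
  "grow_head [] = []"
| "grow_head (n # ps) = Suc n # ps"

text \<open>Prepending \<open>a = (a - b) + b\<close> to a basis element enlarges the first part or adds a part 1.\<close>

fun word_coords :: "letter list \<Rightarrow> (nat list \<Rightarrow>\<^sub>0 'k::field)" where
  "word_coords [] = Poly_Mapping.single [1] 1"
| "word_coords (LA # w) =
     lin_ext (\<lambda>p. Poly_Mapping.single (grow_head p) 1 + Poly_Mapping.single (1 # p) 1) (word_coords w)"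
| "word_coords (LB # w) = lin_ext (\<lambda>p. Poly_Mapping.single (1 # p) 1) (word_coords w)"

definition coords :: "'k::field ab_poly \<Rightarrow> (nat list \<Rightarrow>\<^sub>0 'k)" where
  "coords = lin_ext word_coords"

lemma linear_coords: "plinear coords"
  by (simp add: coords_def linear_lin_ext)

lemma lin_ext_keysE:
  assumes "y \<in> Poly_Mapping.keys (lin_ext f p)"
  obtains x where "x \<in> Poly_Mapping.keys p" "y \<in> Poly_Mapping.keys (f x)"
proof -
  have "\<exists>x\<in>Poly_Mapping.keys p. y \<in> Poly_Mapping.keys (f x)"
  proof (rule ccontr)
    assume "\<not> ?thesis"
    then have "Poly_Mapping.lookup (f x) y = 0" if "x \<in> Poly_Mapping.keys p" for x
      using that by (simp add: in_keys_iff)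
    then have "Poly_Mapping.lookup (lin_ext f p) y = 0"
      by (simp add: lin_ext_def lookup_sum)
    then show False using assms by (simp add: in_keys_iff)
  qed
  then show ?thesis using that by blast
qed

lemma word_coords_keys:
  "p \<in> Poly_Mapping.keys (word_coords w :: nat list \<Rightarrow>\<^sub>0 'k::field) \<Longrightarrow> composition p \<and> p \<noteq> []"
proof (induction w arbitrary: p)
  case (Cons l w)
  show ?case
  proof (cases l)
    case LA
    from Cons.prems obtain q where q: "q \<in> Poly_Mapping.keys (word_coords w :: nat list \<Rightarrow>\<^sub>0 'k)"
      and p: "p \<in> Poly_Mapping.keys (Poly_Mapping.single (grow_head q) (1::'k) + Poly_Mapping.single (1 # q) 1)"
      unfolding LA word_coords.simps by (rule lin_ext_keysE)
    have "p \<in> Poly_Mapping.keys (Poly_Mapping.single (grow_head q) (1::'k)) \<union> Poly_Mapping.keys (Poly_Mapping.single (1 # q) (1::'k))"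
      by (rule subsetD[OF Poly_Mapping.keys_add p])
    then have "p = grow_head q \<or> p = 1 # q"
      by auto
    then show ?thesis using Cons.IH[OF q] by (cases q) auto
  next
    case LB
    from Cons.prems obtain q where "q \<in> Poly_Mapping.keys (word_coords w :: nat list \<Rightarrow>\<^sub>0 'k)"
      and "p \<in> Poly_Mapping.keys (Poly_Mapping.single (1 # q) (1::'k))"
      unfolding LB word_coords.simps by (rule lin_ext_keysE)
    then show ?thesis using Cons.IH by auto
  qed
qed auto

lemma coords_keys: "p \<in> Poly_Mapping.keys (coords u) \<Longrightarrow> composition p \<and> p \<noteq> []"
  unfolding coords_def by (blast elim: lin_ext_keysE dest: word_coords_keys)

lemma single_Cons: "Poly_Mapping.single (l # w) 1 = Poly_Mapping.single [l] 1 * (Poly_Mapping.single w 1 :: 'k::field ab_poly)"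
  by (simp add: mult_single plus_list_def)

lemma single_Nil: "Poly_Mapping.single [] 1 = (1 :: 'k::field ab_poly)"
  by (metis single_one zero_list_def)

lemma comp_poly_word_coords:
  "lin_ext comp_poly (word_coords w) = (Poly_Mapping.single w 1 :: 'k::field ab_poly)"
proof (induction w)
  case Nil
  then show ?case by (simp add: comp_poly_one single_Nil)
next
  case (Cons l w)
  have grow: "comp_poly (grow_head p) = (va - vb) * (comp_poly p :: 'k ab_poly)"
    and one: "comp_poly (Suc 0 # p) = vb * (comp_poly p :: 'k ab_poly)"
    if "p \<in> Poly_Mapping.keys (word_coords w :: nat list \<Rightarrow>\<^sub>0 'k)" for p
    using word_coords_keys[OF that]
    by (cases p; simp add: comp_poly_grow comp_poly_one_Cons)+
  show ?case
  proof (cases l)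
    case LA
    have "lin_ext comp_poly (word_coords (l # w)) =
        lin_ext (\<lambda>p. comp_poly (grow_head p) + comp_poly (Suc 0 # p)) (word_coords w :: nat list \<Rightarrow>\<^sub>0 'k)"
      by (simp add: LA linear_comp_lin_ext[OF linear_lin_ext] lin_ext_add)
    also have "\<dots> = lin_ext (\<lambda>p. va * comp_poly p) (word_coords w)"
      by (rule lin_ext_cong) (simp add: grow one left_diff_distrib)
    also have "\<dots> = va * lin_ext comp_poly (word_coords w)"
      by (rule linear_comp_lin_ext[OF linear_mult_left, symmetric])
    finally show ?thesis using Cons by (simp add: LA single_Cons[symmetric])
  next
    case LB
    have "lin_ext comp_poly (word_coords (l # w)) =
        lin_ext (\<lambda>p. comp_poly (Suc 0 # p)) (word_coords w :: nat list \<Rightarrow>\<^sub>0 'k)"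
      by (simp add: LB linear_comp_lin_ext[OF linear_lin_ext])
    also have "\<dots> = lin_ext (\<lambda>p. vb * comp_poly p) (word_coords w)"
      by (rule lin_ext_cong) (simp add: one)
    also have "\<dots> = vb * lin_ext comp_poly (word_coords w)"
      by (rule linear_comp_lin_ext[OF linear_mult_left, symmetric])
    finally show ?thesis using Cons by (simp add: LB single_Cons[symmetric])
  qed
qed

text \<open>
  The \<^const>\<open>comp_poly\<close> span; that they are independent is \<open>coords_comp_poly\<close> below.
\<close>

lemma comp_poly_coords: "lin_ext comp_poly (coords u) = u"
  unfolding coords_def
  by (simp add: linear_comp_lin_ext[OF linear_lin_ext] comp_poly_word_coords lin_ext_id)

lemma linear_eq_on_comp_poly:
  assumes "Vector_Spaces.linear pm_scale s f" "Vector_Spaces.linear pm_scale s g"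
    and "\<And>p. composition p \<Longrightarrow> p \<noteq> [] \<Longrightarrow> f (comp_poly p) = g (comp_poly p)"
  shows "f u = g u"
proof -
  have "f (lin_ext comp_poly (coords u)) = g (lin_ext comp_poly (coords u))"
    unfolding linear_of_lin_ext[OF assms(1)] linear_of_lin_ext[OF assms(2)]
    by (intro sum.cong refl arg_cong[where f = "s _"] assms(3)) (blast dest: coords_keys)+
  then show ?thesis by (simp add: comp_poly_coords)
qed

lemma coords_va_mult: "coords (va * u) =
    lin_ext (\<lambda>p. Poly_Mapping.single (grow_head p) 1 + Poly_Mapping.single (1 # p) 1) (coords u)"
  by (rule linear_eq_on_words[where s = pm_scale])
    (auto intro: linear_compose linear_mult_left linear_coords linear_lin_ext
      simp: single_Cons[symmetric] coords_def)

lemma coords_vb_mult: "coords (vb * u) = lin_ext (\<lambda>p. Poly_Mapping.single (1 # p) 1) (coords u)"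
  by (rule linear_eq_on_words[where s = pm_scale])
    (auto intro: linear_compose linear_mult_left linear_coords linear_lin_ext
      simp: single_Cons[symmetric] coords_def)

lemma coords_comp_poly:
  "composition p \<Longrightarrow> p \<noteq> [] \<Longrightarrow> coords (comp_poly p) = Poly_Mapping.single p (1 :: 'k::field)"
proof (induction p rule: composition_induct)
  case one
  then show ?case by (simp add: comp_poly_one coords_def single_Nil[symmetric])
next
  case (grow n qs)
  then show ?case
    by (simp add: comp_poly_grow left_diff_distrib linear_map_diff[OF linear_coords]
        coords_va_mult coords_vb_mult)
next
  case (one_Cons qs)
  then show ?case by (simp add: comp_poly_one_Cons coords_vb_mult)
qed

section \<open>Splittings of exponent lists and quasi-shuffle coefficients\<close>

definition list_splits :: "nat list \<Rightarrow> (nat list \<times> nat list) set" where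
  "list_splits ns = {(is, js). length is = length ns \<and> length js = length ns \<and> map2 (+) is js = ns}"

lemma list_splits_Nil [simp]: "list_splits [] = {([], [])}"
  by (auto simp: list_splits_def)

lemma list_splits_Cons:
  "list_splits (n # ns) = (\<lambda>(x, is, js). (x # is, (n - x) # js)) ` ({..n} \<times> list_splits ns)"
proof (intro set_eqI iffI)
  fix z assume "z \<in> list_splits (n # ns)"
  then obtain x "is" y js where "z = (x # is, y # js)" "(is, js) \<in> list_splits ns" "n = x + y"
    by (auto simp: list_splits_def length_Suc_conv)
  then show "z \<in> (\<lambda>(x, is, js). (x # is, (n - x) # js)) ` ({..n} \<times> list_splits ns)"
    by (intro image_eqI[of _ _ "(x, is, js)"]) auto
next
  fix z assume "z \<in> (\<lambda>(x, is, js). (x # is, (n - x) # js)) ` ({..n} \<times> list_splits ns)"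
  then obtain x "is" js where "z = (x # is, (n - x) # js)" "x \<le> n" "(is, js) \<in> list_splits ns"
    by auto
  then show "z \<in> list_splits (n # ns)"
    by (simp add: list_splits_def)
qed

lemma finite_list_splits [simp]: "finite (list_splits ns)"
  by (induction ns) (simp_all add: list_splits_Cons)

lemma sum_list_splits_Cons:
  "(\<Sum>(is, js)\<in>list_splits (n # ns). f is js) =
    (\<Sum>x\<le>n. \<Sum>(is, js)\<in>list_splits ns. f (x # is) ((n - x) # js))"
proof -
  have "inj_on (\<lambda>(x, is, js). (x # is, (n - x) # js)) ({..n} \<times> list_splits ns)"
    by (auto simp: inj_on_def)
  then show ?thesis
    by (simp add: list_splits_Cons sum.reindex case_prod_unfold sum.cartesian_product)
qed

lemma sum_list_splits_append:
  "(\<Sum>(is, js)\<in>list_splits (a @ b). f is js) =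
    (\<Sum>(is, js)\<in>list_splits a. \<Sum>(is', js')\<in>list_splits b. f (is @ is') (js @ js'))"
proof (induction a arbitrary: f)
  case (Cons n a)
  show ?case
    by (simp add: sum_list_splits_Cons Cons.IH[of "\<lambda>is js. f (_ # is) (_ # js)"])
qed simp

lemma list_splits_sum_list:
  "(is, js) \<in> list_splits ns \<Longrightarrow> sum_list is + sum_list js = sum_list ns"
proof (induction ns arbitrary: "is" js)
  case (Cons n ns)
  then show ?case by (fastforce simp: list_splits_Cons)
qed simp

abbreviation nonzero_parts :: "nat list \<Rightarrow> nat list" where
  "nonzero_parts \<equiv> filter ((<) 0)"

lemma composition_nonzero_parts [simp]: "composition (nonzero_parts ns)"
  by (induction ns) auto

lemma nonzero_parts_composition: "composition ns \<Longrightarrow> nonzero_parts ns = ns"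
  by (induction ns) auto

lemma sum_list_nonzero_parts [simp]: "sum_list (nonzero_parts ns) = sum_list ns"
  by (induction ns) auto

text \<open>
  The coefficient of the monomial quasisymmetric function of \<open>p\<close> at an exponent list, and of the
  product of those of \<open>p\<close> and \<open>q\<close>. At compositions the latter are the structure constants of
  the quasi-shuffle product.
\<close>

definition monomial_coeff :: "nat list \<Rightarrow> nat list \<Rightarrow> 'k::field" where
  "monomial_coeff p ns = (if nonzero_parts ns = p then 1 else 0)"

definition shuffle_coeff :: "nat list \<Rightarrow> nat list \<Rightarrow> nat list \<Rightarrow> 'k::field" where
  "shuffle_coeff p q ns = (\<Sum>(is, js)\<in>list_splits ns. monomial_coeff p is * monomial_coeff q js)"

definition comps :: "nat \<Rightarrow> nat list set" where
  "comps n = {p. composition p \<and> sum_list p = n}"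

lemma comps_0 [simp]: "comps 0 = {[]}"
proof -
  have "p = []" if "composition p" "sum_list p = 0" for p
    using that by (cases p) auto
  then show ?thesis by (auto simp: comps_def)
qed

lemma comps_rec:
  assumes "0 < n" shows "comps n = (\<Union>i\<in>{1..n}. (\<lambda>p. i # p) ` comps (n - i))"
proof (intro set_eqI iffI)
  fix p assume "p \<in> comps n"
  then obtain i q where "p = i # q" "1 \<le> i" "composition q" "i + sum_list q = n"
    using assms by (cases p) (auto simp: comps_def)
  then show "p \<in> (\<Union>i\<in>{1..n}. (\<lambda>p. i # p) ` comps (n - i))"
    by (intro UN_I[of i] image_eqI[of _ _ q]) (auto simp: comps_def)
qed (auto simp: comps_def)

lemma finite_comps [simp]: "finite (comps n)"
proof (induction n rule: less_induct)
  case (less n)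
  then show ?case by (cases "n = 0") (auto simp: comps_rec)
qed

lemma sum_comps_rec:
  assumes "0 < n"
  shows "(\<Sum>p\<in>comps n. f p) = (\<Sum>i\<in>{1..n}. \<Sum>p\<in>comps (n - i). f (i # p))"
proof -
  have "(\<Sum>p\<in>comps n. f p) = (\<Sum>i\<in>{1..n}. \<Sum>p\<in>(\<lambda>p. i # p) ` comps (n - i). f p)"
    unfolding comps_rec[OF assms] by (rule sum.UNION_disjoint) auto
  then show ?thesis by (simp add: sum.reindex)
qed

lemma sum_comps_delta:
  "(\<Sum>p\<in>comps n. monomial_coeff p ns * f p) = (if sum_list ns = n then f (nonzero_parts ns) else (0 :: 'k::field))"
proof -
  have "(\<Sum>p\<in>comps n. monomial_coeff p ns * f p) = (\<Sum>p\<in>comps n. if nonzero_parts ns = p then f p else 0)"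
    by (rule sum.cong) (auto simp: monomial_coeff_def)
  also have "\<dots> = (if nonzero_parts ns \<in> comps n then f (nonzero_parts ns) else 0)"
    by (simp add: sum.delta')
  finally show ?thesis by (simp add: comps_def)
qed

text \<open>
  Used to multiply linear combinations of basis elements: the coefficient at \<open>ns\<close> of the
  product of \<open>\<Sum>\<^sub>p f p QM p\<close> and \<open>\<Sum>\<^sub>q g q QM q\<close> is found by splitting the exponents and
  evaluating \<open>f\<close> and \<open>g\<close> at the two halves.
\<close>

lemma shuffle_coeff_expand:
  fixes f g :: "nat list \<Rightarrow> 'k::field"
  assumes "sum_list ns = m + n"
    and f: "\<And>p. sum_list p \<noteq> m \<Longrightarrow> f p = 0" and g: "\<And>q. sum_list q \<noteq> n \<Longrightarrow> g q = 0"
  shows "(\<Sum>p\<in>comps m. \<Sum>q\<in>comps n. f p * g q * shuffle_coeff p q ns)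
    = (\<Sum>(is, js)\<in>list_splits ns. f (nonzero_parts is) * g (nonzero_parts js))"
proof -
  have "(\<Sum>p\<in>comps m. \<Sum>q\<in>comps n. f p * g q * shuffle_coeff p q ns)
      = (\<Sum>(is, js)\<in>list_splits ns. \<Sum>p\<in>comps m. \<Sum>q\<in>comps n.
          (monomial_coeff p is * f p) * (monomial_coeff q js * g q))"
    unfolding shuffle_coeff_def sum_distrib_left case_prod_unfold
    by (subst sum.swap[of _ "list_splits ns"], subst sum.swap[of _ "list_splits ns"])
      (simp add: mult_ac)
  also have "\<dots> = (\<Sum>(is, js)\<in>list_splits ns.
      (if sum_list is = m then f (nonzero_parts is) else 0) * (if sum_list js = n then g (nonzero_parts js) else 0))"
    by (simp add: sum_product[symmetric] sum_comps_delta)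
  also have "\<dots> = (\<Sum>(is, js)\<in>list_splits ns. f (nonzero_parts is) * g (nonzero_parts js))"
    by (rule sum.cong) (auto simp: f g)
  finally show ?thesis .
qed

text \<open>
  A product of quasisymmetric functions is quasisymmetric: variables with exponent 0 do not
  affect the coefficient.
\<close>

lemma shuffle_coeff_nonzero_parts:
  "shuffle_coeff p q (nonzero_parts ns) = (shuffle_coeff p q ns :: 'k::field)"
proof -
  have "shuffle_coeff p q (a @ nonzero_parts ns) = (shuffle_coeff p q (a @ ns) :: 'k)" for a
  proof (induction ns arbitrary: a)
    case (Cons n ns)
    have zero: "shuffle_coeff p q (a @ 0 # ns) = (shuffle_coeff p q (a @ ns) :: 'k)"
      by (simp add: shuffle_coeff_def sum_list_splits_append sum_list_splits_Cons monomial_coeff_def)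
    show ?case using Cons[of a] Cons[of "a @ [n]"] zero by auto
  qed simp
  from this[of "[]"] show ?thesis by simp
qed

lemma shuffle_coeff_eq_0:
  assumes "sum_list ns \<noteq> sum_list p + sum_list q"
  shows "shuffle_coeff p q ns = (0 :: 'k::field)"
proof -
  have "monomial_coeff p is * monomial_coeff q js = (0 :: 'k)" if "(is, js) \<in> list_splits ns" for "is" js
    using assms list_splits_sum_list[OF that] by (auto simp: monomial_coeff_def)
  then have "\<forall>x\<in>list_splits ns. monomial_coeff p (fst x) * monomial_coeff q (snd x) = (0 :: 'k)"
    by (metis prod.collapse)
  then show ?thesis
    unfolding shuffle_coeff_def by (intro sum.neutral ballI) (simp add: case_prod_unfold del: mult_eq_0_iff)
qed

text \<open>
  If the variables are divided into an initial and a final segment, a monomial of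
  \<open>QM p\<close> uses the first \<open>i\<close> parts of \<open>p\<close> in the former and the other parts in the latter.
\<close>

lemma monomial_coeff_append:
  "monomial_coeff p (a @ b) =
    (\<Sum>i\<le>length p. monomial_coeff (take i p) a * monomial_coeff (drop i p) b :: 'k::field)"
proof -
  have "(\<Sum>i\<le>length p. monomial_coeff (take i p) a * monomial_coeff (drop i p) b :: 'k)
      = (\<Sum>i\<le>length p. if i = length (nonzero_parts a) then monomial_coeff p (a @ b) else 0)"
  proof (rule sum.cong)
    fix i assume "i \<in> {..length p}"
    then have iff: "nonzero_parts a = take i p \<and> nonzero_parts b = drop i p \<longleftrightarrow>
        i = length (nonzero_parts a) \<and> nonzero_parts a @ nonzero_parts b = p"
      by (auto simp: append_eq_conv_conj)
    have "monomial_coeff (take i p) a * monomial_coeff (drop i p) b =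
        (if nonzero_parts a = take i p \<and> nonzero_parts b = drop i p then 1 else 0 :: 'k)"
      by (simp add: monomial_coeff_def)
    also have "\<dots> = (if i = length (nonzero_parts a) then monomial_coeff p (a @ b) else 0)"
      unfolding iff by (simp add: monomial_coeff_def)
    finally show "monomial_coeff (take i p) a * monomial_coeff (drop i p) b =
        (if i = length (nonzero_parts a) then monomial_coeff p (a @ b) else 0 :: 'k)" .
  qed simp
  also have "\<dots> = monomial_coeff p (a @ b)"
    by (auto simp: sum.delta monomial_coeff_def)
  finally show ?thesis by simp
qed

text \<open>
  Deconcatenation is multiplicative for the quasi-shuffle product, because splitting the exponents
  of a concatenation means splitting the exponents of both pieces.
\<close>

lemma shuffle_coeff_append:
  "shuffle_coeff p q (a @ b) =
    (\<Sum>i\<le>length p. \<Sum>j\<le>length q.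
      shuffle_coeff (take i p) (take j q) a * shuffle_coeff (drop i p) (drop j q) b :: 'k::field)"
proof -
  let ?f = "\<lambda>is is' i. monomial_coeff (take i p) is * monomial_coeff (drop i p) is' :: 'k"
  let ?g = "\<lambda>js js' j. monomial_coeff (take j q) js * monomial_coeff (drop j q) js' :: 'k"
  have "shuffle_coeff p q (a @ b) = (\<Sum>x\<in>list_splits a. \<Sum>y\<in>list_splits b.
      \<Sum>i\<le>length p. \<Sum>j\<le>length q. ?f (fst x) (fst y) i * ?g (snd x) (snd y) j)"
    unfolding shuffle_coeff_def sum_list_splits_append monomial_coeff_append sum_product
    by (simp add: case_prod_unfold)
  also have "\<dots> = (\<Sum>i\<le>length p. \<Sum>j\<le>length q. \<Sum>x\<in>list_splits a. \<Sum>y\<in>list_splits b.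
      ?f (fst x) (fst y) i * ?g (snd x) (snd y) j)"
    by (simp only: sum.swap[of _ "{..length q}" "list_splits b"] sum.swap[of _ "{..length q}" "list_splits a"]
        sum.swap[of _ "{..length p}" "list_splits b"] sum.swap[of _ "{..length p}" "list_splits a"])
  also have "\<dots> = (\<Sum>i\<le>length p. \<Sum>j\<le>length q.
      shuffle_coeff (take i p) (take j q) a * shuffle_coeff (drop i p) (drop j q) b)"
    by (simp add: shuffle_coeff_def sum_product case_prod_unfold mult_ac sum.swap[of _ "list_splits a" "list_splits b"])
  finally show ?thesis .
qed

lemma shuffle_coeff_Nil_right: "composition r \<Longrightarrow> shuffle_coeff p [] r = (monomial_coeff p r :: 'k::field)"
proof (induction r arbitrary: p)
  case (Cons n r)
  have "(shuffle_coeff p [] (n # r) :: 'k) = (\<Sum>x\<le>n. \<Sum>(is, js)\<in>list_splits r.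
      monomial_coeff p (x # is) * monomial_coeff [] ((n - x) # js))"
    by (simp add: shuffle_coeff_def sum_list_splits_Cons)
  also have "\<dots> = (\<Sum>x\<in>{n}. \<Sum>(is, js)\<in>list_splits r.
      monomial_coeff p (x # is) * monomial_coeff [] ((n - x) # js))"
    by (rule sum.mono_neutral_right) (auto simp: monomial_coeff_def)
  also have "\<dots> = monomial_coeff p (n # r)"
  proof (cases p)
    case Nil
    then show ?thesis using Cons by (simp add: monomial_coeff_def)
  next
    case (Cons k p')
    have "(\<Sum>x\<in>{n}. \<Sum>(is, js)\<in>list_splits r.
        monomial_coeff p (x # is) * monomial_coeff [] ((n - x) # js)) =
        (if k = n then shuffle_coeff p' [] r else 0 :: 'k)"
      using Cons.prems Cons by (auto simp: shuffle_coeff_def monomial_coeff_def intro!: sum.cong)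
    also have "\<dots> = monomial_coeff p (n # r)"
      using Cons Cons.prems Cons.IH[of p'] by (auto simp: monomial_coeff_def)
    finally show ?thesis .
  qed
  finally show ?case .
qed (simp add: shuffle_coeff_def monomial_coeff_def)

lemma list_splits_swap: "(js, is) \<in> list_splits ns \<longleftrightarrow> (is, js) \<in> list_splits ns"
proof (induction ns arbitrary: "is" js)
  case (Cons n ns)
  have "(js, is) \<in> list_splits (n # ns)" if "(is, js) \<in> list_splits (n # ns)" for "is" js
    using that Cons.IH by (force simp: list_splits_Cons image_iff)
  then show ?case by blast
qed auto

lemma shuffle_coeff_commute: "shuffle_coeff p q ns = (shuffle_coeff q p ns :: 'k::field)"
  unfolding shuffle_coeff_def
  by (rule sum.reindex_bij_witness[where i = prod.swap and j = prod.swap])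
    (auto simp: list_splits_swap)

section \<open>The quasi-shuffle product of ab-polynomials\<close>

definition basis_shuffle :: "nat list \<Rightarrow> nat list \<Rightarrow> 'k::field ab_poly" where
  "basis_shuffle p q = (\<Sum>r\<in>comps (sum_list p + sum_list q). pm_scale (shuffle_coeff p q r) (comp_poly r))"

definition shuffle :: "'k::field ab_poly \<Rightarrow> 'k ab_poly \<Rightarrow> 'k ab_poly" where
  "shuffle u v = lin_ext (\<lambda>p. lin_ext (basis_shuffle p) (coords v)) (coords u)"

lemma linear_shuffle_left: "plinear (\<lambda>u. shuffle u v)"
  unfolding shuffle_def by (rule linear_compose[OF linear_coords linear_lin_ext])

lemma linear_shuffle_right: "plinear (shuffle u)"
  by (rule plinearI)
    (simp_all add: shuffle_def linear_map_add[OF linear_coords] linear_map_scale[OF linear_coords]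
      lin_ext_add lin_ext_scale lin_ext_fun_sum lin_ext_fun_scale)

lemma shuffle_comp_poly:
  assumes "composition p" "p \<noteq> []" "composition q" "q \<noteq> []"
  shows "shuffle (comp_poly p) (comp_poly q) = basis_shuffle p q"
  using assms by (simp add: shuffle_def coords_comp_poly)

lemma bilinear_eq_on_comp_poly:
  assumes "\<And>v. Vector_Spaces.linear pm_scale s (\<lambda>u. f u v)" "\<And>u. Vector_Spaces.linear pm_scale s (f u)"
    and "\<And>v. Vector_Spaces.linear pm_scale s (\<lambda>u. g u v)" "\<And>u. Vector_Spaces.linear pm_scale s (g u)"
    and "\<And>p q. composition p \<Longrightarrow> p \<noteq> [] \<Longrightarrow> composition q \<Longrightarrow> q \<noteq> [] \<Longrightarrow>
      f (comp_poly p) (comp_poly q) = g (comp_poly p) (comp_poly q)"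
  shows "f u v = g u v"
  by (rule linear_eq_on_comp_poly[OF assms(1,3)], rule linear_eq_on_comp_poly[OF assms(2,4)])
    (rule assms(5))


section \<open>Ranks in graded posets\<close>

lemma wf_strict_part:
  assumes "Partial_order r" "finite (Field r)"
  shows "wf (r - Id)" "wf ((r - Id)\<inverse>)"
proof -
  have sub: "r \<subseteq> Field r \<times> Field r" by (auto simp: Field_def)
  have fin: "finite r" by (rule finite_subset[OF sub]) (simp add: assms)
  show wf: "wf (r - Id)" using fin assms(1) by (rule partial_order_on_well_order_on)
  show "wf ((r - Id)\<inverse>)"
    using fin wf_acyclic[OF wf] by (intro finite_acyclic_wf_converse) auto
qed

text \<open>
  In a finite poset a maximal element of the half-open interval from \<open>x\<close> to \<open>y\<close> is covered by \<open>y\<close>.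
  Facts about rank functions are proved by descending along such covers.
\<close>

lemma exists_cover:
  assumes r: "Partial_order r" "finite (Field r)" and "(x, y) \<in> r - Id"
  shows "\<exists>c. (x, c) \<in> r \<and> covered r c y"
proof -
  have "trans r" "antisym r" "refl_on (Field r) r"
    using r(1) by (auto simp: partial_order_on_def preorder_on_def)
  let ?Z = "{z. (x, z) \<in> r \<and> (z, y) \<in> r - Id}"
  have "x \<in> ?Z"
    using assms(3) \<open>refl_on (Field r) r\<close> by (auto simp: refl_on_def Field_def)
  with wf_strict_part(2)[OF r] obtain c where c: "c \<in> ?Z" "\<And>z. (z, c) \<in> (r - Id)\<inverse> \<Longrightarrow> z \<notin> ?Z"
    by (rule wfE_min) blast
  have "covered r c y"
    using c \<open>trans r\<close> unfolding covered_def by (auto dest: transD)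
  with c show ?thesis by blast
qed

locale graded =
  fixes r :: "'p rel"
  assumes graded: "graded_poset r"
begin

lemma order: "Partial_order r" and finite_Field: "finite (Field r)"
  using graded by (auto simp: graded_poset_def)

lemma trans_r: "(x, y) \<in> r \<Longrightarrow> (y, z) \<in> r \<Longrightarrow> (x, z) \<in> r"
  and antisym_r: "(x, y) \<in> r \<Longrightarrow> (y, x) \<in> r \<Longrightarrow> x = y"
  and refl_r: "x \<in> Field r \<Longrightarrow> (x, x) \<in> r"
  using order by (auto simp: partial_order_on_def preorder_on_def refl_on_def dest: transD antisymD)

lemma bottom_eqI: "x \<in> Field r \<Longrightarrow> (\<And>y. y \<in> Field r \<Longrightarrow> (x, y) \<in> r) \<Longrightarrow> bottom r = x"
  unfolding bottom_def by (rule the_equality) (auto intro: antisym_r)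

lemma topmost_eqI: "x \<in> Field r \<Longrightarrow> (\<And>y. y \<in> Field r \<Longrightarrow> (y, x) \<in> r) \<Longrightarrow> topmost r = x"
  unfolding topmost_def by (rule the_equality) (auto intro: antisym_r)

lemma bottom_in_Field: "bottom r \<in> Field r"
  and bottom_le: "y \<in> Field r \<Longrightarrow> (bottom r, y) \<in> r"
  using graded bottom_eqI by (metis graded_poset_def)+

lemma topmost_in_Field: "topmost r \<in> Field r"
  and le_topmost: "y \<in> Field r \<Longrightarrow> (y, topmost r) \<in> r"
  using graded topmost_eqI by (metis graded_poset_def)+

lemma rank_function_less:
  assumes "rank_function r \<rho>"
  shows "(x, y) \<in> r - Id \<Longrightarrow> \<rho> x < \<rho> y"
proof (induction y rule: wf_induct[OF wf_strict_part(1)[OF order finite_Field]])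
  case (1 y)
  then obtain c where c: "(x, c) \<in> r" "covered r c y"
    using exists_cover[OF order finite_Field] by blast
  then have "\<rho> y = \<rho> c + 1" and "(c, y) \<in> r - Id"
    using assms by (auto simp: rank_function_def covered_def)
  moreover have "x = c \<or> \<rho> x < \<rho> c"
    using 1 c \<open>(c, y) \<in> r - Id\<close> by blast
  ultimately show ?case by auto
qed

lemma rank_function_unique:
  assumes "rank_function r \<rho>" "rank_function r \<sigma>"
  shows "y \<in> Field r \<Longrightarrow> \<rho> y = \<sigma> y"
proof (induction y rule: wf_induct[OF wf_strict_part(1)[OF order finite_Field]])
  case (1 y)
  show ?case
  proof (cases "y = bottom r")
    case True
    then show ?thesis using assms by (simp add: rank_function_def)
  next
    case False
    then have "(bottom r, y) \<in> r - Id" using bottom_le 1 by auto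
    then obtain c where c: "covered r c y"
      using exists_cover[OF order finite_Field] by blast
    then have "(c, y) \<in> r - Id" "c \<in> Field r" by (auto simp: covered_def Field_def)
    then have "\<rho> c = \<sigma> c" using 1 by blast
    then show ?thesis using assms c by (simp add: rank_function_def)
  qed
qed

abbreviation rk :: "'p \<Rightarrow> nat" where "rk \<equiv> poset_rank r"

lemma rank_function_rk: "rank_function r rk"
  using graded by (metis graded_poset_def poset_rank_def someI_ex)

lemma rk_eq: "rank_function r \<rho> \<Longrightarrow> x \<in> Field r \<Longrightarrow> rk x = \<rho> x"
  using rank_function_unique rank_function_rk by blast

lemma rk_less: "(x, y) \<in> r \<Longrightarrow> x \<noteq> y \<Longrightarrow> rk x < rk y"
  using rank_function_less[OF rank_function_rk] by blast

lemma rk_le: "(x, y) \<in> r \<Longrightarrow> rk x \<le> rk y"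
  using rk_less by fastforce

lemma rk_bottom: "rk (bottom r) = 0"
  using rank_function_rk by (simp add: rank_function_def)

end


section \<open>Counting chains with prescribed rank steps\<close>

definition at_height :: "'p rel \<Rightarrow> ('p \<Rightarrow> nat) \<Rightarrow> 'p \<Rightarrow> nat \<Rightarrow> 'p set" where
  "at_height r \<rho> x n = {z. (x, z) \<in> r \<and> \<rho> z = \<rho> x + n}"

text \<open>
  Weakly increasing chains from \<open>x\<close> to \<open>y\<close> with prescribed rank steps. A step 0 repeats an
  element, so for positive steps these are the strict chains, while for arbitrary steps
  they correspond to monomials in all the variables of the quasisymmetric function of the poset.
\<close>

fun multichains :: "'p rel \<Rightarrow> ('p \<Rightarrow> nat) \<Rightarrow> 'p \<Rightarrow> 'p \<Rightarrow> nat list \<Rightarrow> nat" where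
  "multichains r \<rho> y x [] = (if x = y then 1 else 0)"
| "multichains r \<rho> y x (n # ns) = (\<Sum>z\<in>at_height r \<rho> x n. multichains r \<rho> y z ns)"

definition strict_chains :: "'p rel \<Rightarrow> 'p \<Rightarrow> 'p \<Rightarrow> 'p list set" where
  "strict_chains r x y = {xs. xs \<noteq> [] \<and> set xs \<subseteq> Field r \<and> sorted_wrt (\<lambda>x y. (x, y) \<in> r - Id) xs
     \<and> hd xs = x \<and> last xs = y}"

abbreviation rank_steps :: "('p \<Rightarrow> nat) \<Rightarrow> 'p list \<Rightarrow> nat list" where
  "rank_steps \<rho> xs \<equiv> map2 (\<lambda>x y. \<rho> y - \<rho> x) xs (tl xs)"

context graded
begin

lemma finite_at_height: "finite (at_height r \<rho> x n)"
  by (rule finite_subset[OF _ finite_Field]) (auto simp: at_height_def Field_def)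

lemma at_height_0: "x \<in> Field r \<Longrightarrow> at_height r rk x 0 = {x}"
  using rk_less refl_r by (fastforce simp: at_height_def)

lemma multichains_nonzero_parts:
  "x \<in> Field r \<Longrightarrow> multichains r rk y x (nonzero_parts ns) = multichains r rk y x ns"
proof (induction ns arbitrary: x)
  case (Cons n ns)
  have "z \<in> Field r" if "z \<in> at_height r rk x n" for z
    using that by (auto simp: at_height_def Field_def)
  then show ?case using Cons by (auto simp: at_height_0 intro!: sum.cong)
qed simp

lemma multichains_eq_0: "rk y \<noteq> rk x + sum_list ns \<Longrightarrow> multichains r rk y x ns = 0"
  by (induction ns arbitrary: x) (auto simp: at_height_def)

lemma strict_chains_single: "[z] \<in> strict_chains r x y \<longleftrightarrow> x \<in> Field r \<and> z = x \<and> x = y"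
  by (auto simp: strict_chains_def)

lemma strict_chains_Cons:
  "z # w # xs \<in> strict_chains r x y \<longleftrightarrow> z = x \<and> (x, w) \<in> r - Id \<and> w # xs \<in> strict_chains r w y"
proof
  assume "z # w # xs \<in> strict_chains r x y"
  then show "z = x \<and> (x, w) \<in> r - Id \<and> w # xs \<in> strict_chains r w y"
    by (auto simp: strict_chains_def)
next
  assume *: "z = x \<and> (x, w) \<in> r - Id \<and> w # xs \<in> strict_chains r w y"
  then have "(x, v) \<in> r - Id" if "v \<in> set xs" for v
    using that trans_r antisym_r by (auto simp: strict_chains_def)
  with * show "z # w # xs \<in> strict_chains r x y"
    by (auto simp: strict_chains_def Field_def)
qed

lemma finite_strict_chains: "finite (strict_chains r x y)"
proof (rule finite_subset)
  show "strict_chains r x y \<subseteq> {xs. set xs \<subseteq> Field r \<and> length xs \<le> card (Field r)}"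
  proof safe
    fix xs assume xs: "xs \<in> strict_chains r x y"
    show "z \<in> Field r" if "z \<in> set xs" for z
      using xs that by (auto simp: strict_chains_def)
    have "distinct xs"
      using xs by (auto simp: strict_chains_def strict_sorted_iff sorted_wrt_iff_nth_less distinct_conv_nth)
        (metis nat_neq_iff)
    moreover have "card (set xs) \<le> card (Field r)"
      using xs finite_Field by (intro card_mono) (auto simp: strict_chains_def)
    ultimately show "length xs \<le> card (Field r)"
      by (simp add: distinct_card)
  qed
qed (rule finite_lists_length_le[OF finite_Field])

lemma rank_steps_strict_chain:
  "xs \<in> strict_chains r x y \<Longrightarrow> composition (rank_steps rk xs) \<and> rk y = rk x + sum_list (rank_steps rk xs)"
proof (induction xs arbitrary: x)
  case (Cons z xs)
  show ?case
  proof (cases xs)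
    case Nil
    then show ?thesis using Cons.prems by (simp add: strict_chains_single)
  next
    case (Cons w ws)
    then have "z = x" "(x, w) \<in> r" "x \<noteq> w" and "xs \<in> strict_chains r w y"
      using Cons.prems by (auto simp: strict_chains_Cons)
    then show ?thesis using Cons Cons.IH rk_less[of x w] by (auto simp: Suc_le_eq)
  qed
qed (simp add: strict_chains_def)

lemma card_strict_chains:
  "x \<in> Field r \<Longrightarrow> composition p \<Longrightarrow>
    card {xs \<in> strict_chains r x y. rank_steps rk xs = p} = multichains r rk y x p"
proof (induction p arbitrary: x)
  case Nil
  have "{xs \<in> strict_chains r x y. rank_steps rk xs = []} = (if x = y then {[x]} else {})"
  proof -
    have "xs = [x] \<and> x = y" if "xs \<in> strict_chains r x y" "rank_steps rk xs = []" for xs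
      using that by (cases xs rule: remdups_adj.cases) (auto simp: strict_chains_single strict_chains_def)
    then show ?thesis using Nil by (auto simp: strict_chains_single)
  qed
  then show ?case by simp
next
  case (Cons n p)
  let ?S = "\<lambda>z. {xs \<in> strict_chains r z y. rank_steps rk xs = p}"
  have "{xs \<in> strict_chains r x y. rank_steps rk xs = n # p} = (\<Union>z\<in>at_height r rk x n. (\<lambda>xs. x # xs) ` ?S z)"
  proof (intro set_eqI iffI)
    fix xs assume "xs \<in> {xs \<in> strict_chains r x y. rank_steps rk xs = n # p}"
    then have xs: "xs \<in> strict_chains r x y" "rank_steps rk xs = n # p" by auto
    then obtain z zs where "xs = x # z # zs"
      by (cases xs rule: remdups_adj.cases) (auto simp: strict_chains_def)
    then have "(x, z) \<in> r - Id" "z # zs \<in> ?S z" "rk z - rk x = n"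
      using xs by (auto simp: strict_chains_Cons)
    then show "xs \<in> (\<Union>z\<in>at_height r rk x n. (\<lambda>xs. x # xs) ` ?S z)"
      using rk_less[of x z] \<open>xs = x # z # zs\<close> by (auto simp: at_height_def intro!: bexI[of _ z])
  next
    fix xs assume "xs \<in> (\<Union>z\<in>at_height r rk x n. (\<lambda>xs. x # xs) ` ?S z)"
    then obtain z zs where z: "z \<in> at_height r rk x n" "zs \<in> ?S z" "xs = x # zs" by auto
    then obtain zs' where "zs = z # zs'" by (cases zs) (auto simp: strict_chains_def)
    then show "xs \<in> {xs \<in> strict_chains r x y. rank_steps rk xs = n # p}"
      using z Cons.prems by (auto simp: strict_chains_Cons at_height_def)
  qed
  also have "card \<dots> = (\<Sum>z\<in>at_height r rk x n. card ((\<lambda>xs. x # xs) ` ?S z))"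
  proof (rule card_UN_disjoint[OF finite_at_height])
    show "\<forall>z\<in>at_height r rk x n. finite ((\<lambda>xs. x # xs) ` ?S z)"
      using finite_strict_chains by simp
    show "\<forall>z\<in>at_height r rk x n. \<forall>w\<in>at_height r rk x n. z \<noteq> w \<longrightarrow>
        (\<lambda>xs. x # xs) ` ?S z \<inter> (\<lambda>xs. x # xs) ` ?S w = {}"
      by (auto simp: strict_chains_def)
  qed
  also have "\<dots> = (\<Sum>z\<in>at_height r rk x n. multichains r rk y z p)"
  proof (rule sum.cong)
    fix z assume "z \<in> at_height r rk x n"
    then have "z \<in> Field r" by (auto simp: at_height_def Field_def)
    then show "card ((\<lambda>xs. x # xs) ` ?S z) = multichains r rk y z p"
      using Cons by (simp add: card_image)
  qed simp
  finally show ?case by simp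
qed

lemma of_nat_mult_ab_poly: "of_nat n * u = pm_scale (of_nat n) (u :: 'k::field ab_poly)"
  by (induction n) (simp_all add: distrib_right pm_scale_add_left)

text \<open>
  Grouping the chains by their rank steps gives the coordinates of the ab-index.
\<close>

lemma ab_index_eq:
  "ab_index r = (\<Sum>p\<in>comps (rk (topmost r)).
    pm_scale (of_nat (multichains r rk (topmost r) (bottom r) p)) (comp_poly p :: 'k::field ab_poly))"
proof -
  let ?C = "strict_chains r (bottom r) (topmost r)"
  have "ab_index r = (\<Sum>xs\<in>?C. comp_poly (rank_steps rk xs) :: 'k ab_poly)"
    by (simp add: ab_index_def full_chains_def strict_chains_def)
  also have "\<dots> = (\<Sum>p\<in>comps (rk (topmost r)). of_nat (card {xs \<in> ?C. rank_steps rk xs = p}) * comp_poly p)"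
    by (rule sum_fun_comp[OF finite_strict_chains finite_comps])
      (auto simp: comps_def rk_bottom dest: rank_steps_strict_chain)
  also have "\<dots> = (\<Sum>p\<in>comps (rk (topmost r)).
      pm_scale (of_nat (multichains r rk (topmost r) (bottom r) p)) (comp_poly p))"
    by (rule sum.cong) (simp_all add: of_nat_mult_ab_poly card_strict_chains bottom_in_Field comps_def)
  finally show ?thesis .
qed

end

section \<open>The ab-index of a Cartesian product\<close>

lemma in_poset_prod [simp]: "((x, y), (x', y')) \<in> poset_prod r s \<longleftrightarrow> (x, x') \<in> r \<and> (y, y') \<in> s"
  by (simp add: poset_prod_def)

locale graded_pair = P: graded r + Q: graded s for r :: "'p rel" and s :: "'q rel"
begin

lemma Field_prod: "Field (poset_prod r s) = Field r \<times> Field s"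
proof
  show "Field (poset_prod r s) \<subseteq> Field r \<times> Field s"
    by (auto simp: Field_def)
  show "Field r \<times> Field s \<subseteq> Field (poset_prod r s)"
  proof
    fix z assume "z \<in> Field r \<times> Field s"
    then have "(z, z) \<in> poset_prod r s" using P.refl_r Q.refl_r by (cases z) auto
    then show "z \<in> Field (poset_prod r s)" by (rule FieldI1)
  qed
qed

lemma order_prod: "Partial_order (poset_prod r s)"
proof -
  have "poset_prod r s \<subseteq> Field (poset_prod r s) \<times> Field (poset_prod r s)"
    by (auto simp: Field_def)
  moreover have "refl_on (Field (poset_prod r s)) (poset_prod r s)"
    unfolding Field_prod using P.refl_r Q.refl_r by (auto simp: refl_on_def)
  moreover have "trans (poset_prod r s)"
    by (rule transI) (auto intro: P.trans_r Q.trans_r)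
  moreover have "antisym (poset_prod r s)"
    by (rule antisymI) (auto intro: P.antisym_r Q.antisym_r)
  ultimately show ?thesis by (simp add: partial_order_on_def preorder_on_def)
qed

text \<open>
  If both coordinates increased, \<open>(x', y)\<close> would lie strictly between.
\<close>

lemma covered_prod:
  assumes "covered (poset_prod r s) (x, y) (x', y')"
  shows "x = x' \<and> covered s y y' \<or> y = y' \<and> covered r x x'"
proof -
  have le: "(x, x') \<in> r" "(y, y') \<in> s" "(x, y) \<noteq> (x', y')"
    and between: "\<And>u v. (x, u) \<in> r \<Longrightarrow> (u, x') \<in> r \<Longrightarrow> (y, v) \<in> s \<Longrightarrow> (v, y') \<in> s \<Longrightarrow> (u, v) = (x, y) \<or> (u, v) = (x', y')"
    using assms by (auto simp: covered_def)
  have refl: "(x, x) \<in> r" "(x', x') \<in> r" "(y, y) \<in> s" "(y', y') \<in> s"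
    using le P.refl_r Q.refl_r by (auto simp: Field_def)
  then have "x = x' \<or> y = y'" using between[of x' y] le by auto
  moreover have "covered s y y'" if "x = x'"
    using that le refl between[of x] unfolding covered_def by auto
  moreover have "covered r x x'" if "y = y'"
    using that le refl between[of _ y] unfolding covered_def by auto
  ultimately show ?thesis by blast
qed

lemma bottom_prod_le: "z \<in> Field (poset_prod r s) \<Longrightarrow> ((bottom r, bottom s), z) \<in> poset_prod r s"
  and le_topmost_prod: "z \<in> Field (poset_prod r s) \<Longrightarrow> (z, (topmost r, topmost s)) \<in> poset_prod r s"
  by (cases z; simp add: Field_prod P.bottom_le Q.bottom_le P.le_topmost Q.le_topmost)+

lemma bottom_prod: "bottom (poset_prod r s) = (bottom r, bottom s)"
  unfolding bottom_def[of "poset_prod r s"]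
proof (rule the_equality)
  fix z assume "z \<in> Field (poset_prod r s) \<and> (\<forall>y\<in>Field (poset_prod r s). (z, y) \<in> poset_prod r s)"
  then show "z = (bottom r, bottom s)"
    using bottom_prod_le[of z] P.bottom_in_Field Q.bottom_in_Field P.antisym_r Q.antisym_r
    by (cases z) (auto simp: Field_prod)
qed (simp add: Field_prod P.bottom_in_Field Q.bottom_in_Field P.bottom_le Q.bottom_le)

lemma rank_function_prod: "rank_function (poset_prod r s) (\<lambda>(x, y). P.rk x + Q.rk y)"
  using P.rank_function_rk Q.rank_function_rk covered_prod
  by (fastforce simp: rank_function_def bottom_prod)

lemma graded_prod: "graded_poset (poset_prod r s)"
proof -
  have "(bottom r, bottom s) \<in> Field (poset_prod r s)" "(topmost r, topmost s) \<in> Field (poset_prod r s)"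
    by (simp_all add: Field_prod P.bottom_in_Field Q.bottom_in_Field P.topmost_in_Field Q.topmost_in_Field)
  moreover have "finite (Field (poset_prod r s))"
    by (simp add: Field_prod P.finite_Field Q.finite_Field)
  ultimately show ?thesis
    unfolding graded_poset_def
    using order_prod rank_function_prod bottom_prod_le le_topmost_prod by blast
qed

sublocale PQ: graded "poset_prod r s"
  by unfold_locales (rule graded_prod)

lemma topmost_prod: "topmost (poset_prod r s) = (topmost r, topmost s)"
  by (rule PQ.topmost_eqI)
    (auto simp: Field_prod P.topmost_in_Field Q.topmost_in_Field P.le_topmost Q.le_topmost)

lemma rk_prod: "x \<in> Field r \<Longrightarrow> y \<in> Field s \<Longrightarrow> PQ.rk (x, y) = P.rk x + Q.rk y"
  using PQ.rk_eq[OF rank_function_prod, of "(x, y)"] by (simp add: Field_prod)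

lemma at_height_prod:
  assumes "x \<in> Field r" "y \<in> Field s"
  shows "at_height (poset_prod r s) PQ.rk (x, y) n =
    (\<Union>i\<in>{..n}. at_height r P.rk x i \<times> at_height s Q.rk y (n - i))"
proof -
  have rank: "PQ.rk (x', y') = PQ.rk (x, y) + n \<longleftrightarrow>
      (\<exists>i\<le>n. P.rk x' = P.rk x + i \<and> Q.rk y' = Q.rk y + (n - i))"
    if "(x, x') \<in> r" "(y, y') \<in> s" for x' y'
  proof -
    have "x' \<in> Field r" "y' \<in> Field s" using that by (auto simp: Field_def)
    then show ?thesis
      using assms P.rk_le[OF that(1)] Q.rk_le[OF that(2)]
      by (auto simp: rk_prod intro!: exI[of _ "P.rk x' - P.rk x"])
  qed
  show ?thesis
  proof (intro set_eqI)
    fix z :: "'p \<times> 'q"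
    obtain x' y' where "z = (x', y')" by (cases z)
    then show "z \<in> at_height (poset_prod r s) PQ.rk (x, y) n \<longleftrightarrow>
        z \<in> (\<Union>i\<in>{..n}. at_height r P.rk x i \<times> at_height s Q.rk y (n - i))"
      using rank[of x' y'] by (auto simp: at_height_def)
  qed
qed

text \<open>
  Splitting the rank step of a multichain in the product into the rank steps of
  its two coordinates gives the factorisation of the quasisymmetric function of a product.
\<close>

lemma multichains_prod:
  assumes "x \<in> Field r" "y \<in> Field s"
  shows "multichains (poset_prod r s) PQ.rk (x', y') (x, y) ns =
    (\<Sum>(is, js)\<in>list_splits ns. multichains r P.rk x' x is * multichains s Q.rk y' y js)"
  using assms
proof (induction ns arbitrary: x y)
  case (Cons n ns)
  let ?A = "at_height r P.rk x" and ?B = "at_height s Q.rk y"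
  let ?M = "multichains r P.rk x'" and ?N = "multichains s Q.rk y'"
  have "multichains (poset_prod r s) PQ.rk (x', y') (x, y) (n # ns) =
      (\<Sum>z\<in>(\<Union>i\<in>{..n}. ?A i \<times> ?B (n - i)). multichains (poset_prod r s) PQ.rk (x', y') z ns)"
    using Cons.prems by (simp add: at_height_prod)
  also have "\<dots> = (\<Sum>i\<le>n. \<Sum>z\<in>?A i \<times> ?B (n - i). multichains (poset_prod r s) PQ.rk (x', y') z ns)"
    by (rule sum.UNION_disjoint) (auto simp: P.finite_at_height Q.finite_at_height, auto simp: at_height_def)
  also have "\<dots> = (\<Sum>i\<le>n. \<Sum>z\<in>?A i \<times> ?B (n - i). \<Sum>(is, js)\<in>list_splits ns. ?M (fst z) is * ?N (snd z) js)"
    by (intro sum.cong refl) (auto simp: at_height_def intro!: Cons.IH intro: FieldI2)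
  also have "\<dots> = (\<Sum>i\<le>n. \<Sum>(is, js)\<in>list_splits ns. \<Sum>z\<in>?A i \<times> ?B (n - i). ?M (fst z) is * ?N (snd z) js)"
    by (simp only: sum.swap[of _ "list_splits ns"] case_prod_unfold)
  also have "\<dots> = (\<Sum>i\<le>n. \<Sum>(is, js)\<in>list_splits ns. ?M x (i # is) * ?N y ((n - i) # js))"
    by (simp add: sum_product sum.cartesian_product case_prod_unfold)
  finally show ?case by (simp add: sum_list_splits_Cons)
qed simp

lemma ab_index_prod:
  assumes "1 \<le> P.rk (topmost r)" "1 \<le> Q.rk (topmost s)"
  shows "ab_index (poset_prod r s) = shuffle (ab_index r) (ab_index s :: 'k::field ab_poly)"
proof -
  let ?m = "P.rk (topmost r)" and ?n = "Q.rk (topmost s)"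
  let ?M = "\<lambda>p. of_nat (multichains r P.rk (topmost r) (bottom r) p) :: 'k"
  let ?N = "\<lambda>q. of_nat (multichains s Q.rk (topmost s) (bottom s) q) :: 'k"
  have nonempty: "p \<noteq> []" if "p \<in> comps k" "1 \<le> k" for p k
    using that by (auto simp: comps_def)
  have "shuffle (ab_index r) (ab_index s) =
      (\<Sum>p\<in>comps ?m. \<Sum>q\<in>comps ?n. pm_scale (?M p * ?N q) (shuffle (comp_poly p) (comp_poly q)))"
    unfolding P.ab_index_eq Q.ab_index_eq linear_map_sum[OF linear_shuffle_left]
      linear_map_sum[OF linear_shuffle_right] linear_map_scale[OF linear_shuffle_left]
      linear_map_scale[OF linear_shuffle_right]
    by (simp add: pm_scale_sum mult.commute sum.swap[of _ "comps ?m" "comps ?n"])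
  also have "\<dots> = (\<Sum>p\<in>comps ?m. \<Sum>q\<in>comps ?n. \<Sum>c\<in>comps (?m + ?n).
      pm_scale (?M p * ?N q * shuffle_coeff p q c) (comp_poly c))"
    by (intro sum.cong refl)
      (use nonempty assms in \<open>auto simp: shuffle_comp_poly basis_shuffle_def comps_def pm_scale_sum\<close>)
  also have "\<dots> = (\<Sum>c\<in>comps (?m + ?n).
      pm_scale (\<Sum>p\<in>comps ?m. \<Sum>q\<in>comps ?n. ?M p * ?N q * shuffle_coeff p q c) (comp_poly c))"
    by (simp only: pm_scale_sum_left sum.swap[of _ "comps (?m + ?n)"])
  also have "\<dots> = (\<Sum>c\<in>comps (?m + ?n).
      pm_scale (of_nat (multichains (poset_prod r s) PQ.rk (topmost r, topmost s) (bottom r, bottom s) c)) (comp_poly c))"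
  proof (intro sum.cong refl arg_cong[where f = "\<lambda>a. pm_scale a _"])
    fix c assume "c \<in> comps (?m + ?n)"
    then have "(\<Sum>p\<in>comps ?m. \<Sum>q\<in>comps ?n. ?M p * ?N q * shuffle_coeff p q c)
        = (\<Sum>(is, js)\<in>list_splits c. ?M (nonzero_parts is) * ?N (nonzero_parts js))"
      by (intro shuffle_coeff_expand)
        (auto simp: comps_def P.rk_bottom Q.rk_bottom P.multichains_eq_0 Q.multichains_eq_0)
    then show "(\<Sum>p\<in>comps ?m. \<Sum>q\<in>comps ?n. ?M p * ?N q * shuffle_coeff p q c)
        = of_nat (multichains (poset_prod r s) PQ.rk (topmost r, topmost s) (bottom r, bottom s) c)"
      by (simp add: multichains_prod P.bottom_in_Field Q.bottom_in_Field
          P.multichains_nonzero_parts Q.multichains_nonzero_parts case_prod_unfold)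
  qed
  also have "\<dots> = ab_index (poset_prod r s)"
    by (simp add: PQ.ab_index_eq topmost_prod bottom_prod rk_prod P.topmost_in_Field Q.topmost_in_Field)
  finally show ?thesis by simp
qed

end


section \<open>The ab-indices of layered posets span\<close>

text \<open>
  The poset with ranks \<open>0, \<dots>, d\<close>, where \<open>d = Suc (length ls)\<close>, in which elements of different
  rank are always comparable, and where rank \<open>i\<close> with \<open>0 < i < d\<close> has two elements if the
  \<open>i\<close>-th letter is \<open>b\<close> and one otherwise. The elements of rank \<open>i\<close> are \<open>2 i\<close> and possibly \<open>2 i + 1\<close>.
\<close>

definition layer_elems :: "letter list \<Rightarrow> nat set" where
  "layer_elems ls = {x. x \<le> 2 * Suc (length ls) \<and> (odd x \<longrightarrow> 2 \<le> x \<and> ls ! (x div 2 - 1) = LB)}"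

definition layered :: "letter list \<Rightarrow> nat rel" where
  "layered ls = {(x, y). x \<in> layer_elems ls \<and> y \<in> layer_elems ls \<and> (x = y \<or> x div 2 < y div 2)}"

lemma Field_layered: "Field (layered ls) = layer_elems ls"
  by (auto simp: layered_def Field_def)

lemma layered_between:
  assumes "(x, y) \<in> layered ls" "x div 2 < i" "i < y div 2"
  shows "(x, 2 * i) \<in> layered ls" "(2 * i, y) \<in> layered ls"
proof -
  have "y div 2 \<le> Suc (length ls)" using assms(1) by (auto simp: layered_def layer_elems_def)
  then have "2 * i \<in> layer_elems ls" using assms(3) by (auto simp: layer_elems_def)
  then show "(x, 2 * i) \<in> layered ls" "(2 * i, y) \<in> layered ls"
    using assms by (auto simp: layered_def)
qed

lemma bottom_le_layered: "x \<in> layer_elems ls \<Longrightarrow> (0, x) \<in> layered ls"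
proof -
  assume x: "x \<in> layer_elems ls"
  then have "x = 0 \<or> 0 < x div 2" by (auto simp: layer_elems_def) 
  with x show ?thesis by (auto simp: layered_def layer_elems_def)
qed

lemma le_topmost_layered: "x \<in> layer_elems ls \<Longrightarrow> (x, 2 * Suc (length ls)) \<in> layered ls"
  by (auto simp: layered_def layer_elems_def)

lemma bottom_layered: "bottom (layered ls) = 0"
  unfolding bottom_def Field_layered
proof (rule the_equality)
  fix x assume "x \<in> layer_elems ls \<and> (\<forall>y\<in>layer_elems ls. (x, y) \<in> layered ls)"
  then have "(x, 0) \<in> layered ls" by (auto simp: layer_elems_def)
  then show "x = 0" by (auto simp: layered_def)
qed (auto simp: bottom_le_layered, simp add: layer_elems_def)

lemma rank_function_layered: "rank_function (layered ls) (\<lambda>x. x div 2)"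
proof -
  have "y div 2 = x div 2 + 1" if "covered (layered ls) x y" for x y
  proof (rule ccontr)
    assume *: "y div 2 \<noteq> x div 2 + 1"
    have xy: "(x, y) \<in> layered ls" "x div 2 < y div 2"
      using that by (auto simp: covered_def layered_def)
    with * have "(x, 2 * (x div 2 + 1)) \<in> layered ls - Id" "(2 * (x div 2 + 1), y) \<in> layered ls - Id"
      using layered_between[OF xy(1), of "x div 2 + 1"] by auto
    then show False using that by (auto simp: covered_def)
  qed
  then show ?thesis by (simp add: rank_function_def bottom_layered)
qed

lemma graded_layered: "graded_poset (layered ls)"
proof -
  have "Partial_order (layered ls)"
    unfolding partial_order_on_def preorder_on_def Field_layered
    by (auto simp: refl_on_def layered_def intro!: transI antisymI)
  moreover have "finite (layer_elems ls)"
    by (simp add: layer_elems_def)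
  moreover have "0 \<in> layer_elems ls" "2 * Suc (length ls) \<in> layer_elems ls"
    by (auto simp: layer_elems_def)
  ultimately show ?thesis
    unfolding graded_poset_def Field_layered
    using rank_function_layered bottom_le_layered le_topmost_layered by blast
qed

interpretation layered: graded "layered ls"
  by unfold_locales (rule graded_layered)

lemma topmost_layered: "topmost (layered ls) = 2 * Suc (length ls)"
proof (rule layered.topmost_eqI)
  show "2 * Suc (length ls) \<in> Field (layered ls)" by (simp add: Field_layered layer_elems_def)
qed (simp only: Field_layered le_topmost_layered)

lemma rk_layered: "x \<in> layer_elems ls \<Longrightarrow> poset_rank (layered ls) x = x div 2"
  using layered.rk_eq[OF rank_function_layered] by (simp add: Field_layered)

lemma graded_poset_pos_layered: "graded_poset_pos (layered ls)"
  by (simp add: graded_poset_pos_def graded_layered topmost_layered rk_layered layer_elems_def)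

fun layer_product :: "letter list \<Rightarrow> 'k::field ab_poly" where
  "layer_product [] = 1"
| "layer_product (LA # ls) = va * layer_product ls"
| "layer_product (LB # ls) = (va + vb) * layer_product ls"

lemma layer_product_snoc:
  "layer_product (ls @ [LA]) = layer_product ls * va"
  "layer_product (ls @ [LB]) = layer_product ls * (va + vb)"
  by (induction ls rule: layer_product.induct) (simp_all add: mult.assoc)

lemma sum_comps_Suc:
  assumes "0 < m"
  shows "(\<Sum>p\<in>comps (Suc m). f p) = (\<Sum>p\<in>comps m. f (grow_head p) + f (1 # p))"
proof -
  have "(\<Sum>p\<in>comps (Suc m). f p) = (\<Sum>i\<in>{1..Suc m}. \<Sum>p\<in>comps (Suc m - i). f (i # p))"
    by (rule sum_comps_rec) simp
  also have "\<dots> = (\<Sum>p\<in>comps m. f (1 # p)) + (\<Sum>i\<in>{1..m}. \<Sum>p\<in>comps (m - i). f (Suc i # p))"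
    by (simp add: sum.shift_bounds_cl_Suc_ivl sum.atLeast_Suc_atMost[of 0 m] del: sum.cl_ivl_Suc)
  also have "(\<Sum>i\<in>{1..m}. \<Sum>p\<in>comps (m - i). f (Suc i # p)) = (\<Sum>p\<in>comps m. f (grow_head p))"
    by (simp add: sum_comps_rec[OF assms])
  finally show ?thesis by (simp add: sum.distrib add.commute)
qed

context
  fixes ls :: "letter list"
begin

interpretation layered: graded "layered ls"
  by unfold_locales (rule graded_layered)

private abbreviation W where
  "W \<equiv> multichains (layered ls) (poset_rank (layered ls)) (2 * Suc (length ls))"

lemma at_height_layered:
  assumes "x \<in> layer_elems ls" "1 \<le> n"
  shows "at_height (layered ls) (poset_rank (layered ls)) x n = {z \<in> layer_elems ls. z div 2 = x div 2 + n}"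
proof -
  have "(x, z) \<in> layered ls \<and> poset_rank (layered ls) z = poset_rank (layered ls) x + n \<longleftrightarrow>
      z \<in> layer_elems ls \<and> z div 2 = x div 2 + n" for z
    using assms rk_layered[of x ls] rk_layered[of z ls]
    by (cases "z \<in> layer_elems ls") (auto simp: layered_def[of ls, THEN set_eq_iff[THEN iffD1], rule_format])
  then show ?thesis by (auto simp: at_height_def)
qed

lemma layer_Suc:
  assumes "i < length ls"
  shows "{z \<in> layer_elems ls. z div 2 = Suc i} =
    (if ls ! i = LB then {2 * Suc i, Suc (2 * Suc i)} else {2 * Suc i})"
proof -
  have "z = 2 * Suc i \<or> z = Suc (2 * Suc i)" if "z div 2 = Suc i" for z :: nat
    using that by presburger
  then show ?thesis using assms by (auto simp: layer_elems_def)
qed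

lemma multichains_layered_same_rank:
  assumes "x \<in> layer_elems ls" "y \<in> layer_elems ls" "x div 2 = y div 2" "composition p" "p \<noteq> []"
  shows "W x p = W y p"
  using assms by (cases p) (simp_all add: at_height_layered)

text \<open>
  In a layered poset a chain that skips a rank sees the same elements above as
  one starting a rank higher; so the ab-index of the part above a rank is obtained from that
  above the next rank by a factor \<open>a - b\<close> for skipping and \<open>n b\<close> for visiting the \<open>n\<close>
  elements of that next rank. The factor is \<open>a\<close> for \<open>n = 1\<close> and \<open>a + b\<close> for \<open>n = 2\<close>.
\<close>

lemma multichains_layered_grow:
  assumes "i \<le> length ls" "1 \<le> n"
  shows "W (2 * i) (Suc n # p) = W (2 * Suc i) (n # p)"
proof -
  have "2 * i \<in> layer_elems ls" "2 * Suc i \<in> layer_elems ls"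
    using assms by (auto simp: layer_elems_def)
  then show ?thesis using assms by (simp add: at_height_layered del: mult_Suc_right)
qed

lemma multichains_layered_one:
  assumes "i < length ls" "composition p" "p \<noteq> []"
  shows "W (2 * i) (1 # p) = (if ls ! i = LB then 2 else 1) * W (2 * Suc i) p"
proof -
  have i: "2 * i \<in> layer_elems ls" "2 * Suc i \<in> layer_elems ls"
    using assms by (auto simp: layer_elems_def)
  show ?thesis
  proof (cases "ls ! i = LB")
    case True
    then have "Suc (2 * Suc i) \<in> layer_elems ls" using assms by (auto simp: layer_elems_def)
    then have "W (Suc (2 * Suc i)) p = W (2 * Suc i) p"
      using assms i by (intro multichains_layered_same_rank) auto
    then show ?thesis using True i assms by (simp add: at_height_layered layer_Suc del: mult_Suc_right)
  next
    case False
    then show ?thesis using i assms by (simp add: at_height_layered layer_Suc del: mult_Suc_right)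
  qed
qed

lemma sum_multichains_layered:
  "k \<le> length ls \<Longrightarrow>
    (\<Sum>p\<in>comps (Suc k). pm_scale (of_nat (W (2 * (length ls - k)) p)) (comp_poly p)) =
    (layer_product (drop (length ls - k) ls) :: 'k::field ab_poly)"
proof (induction k)
  case 0
  have "2 * length ls \<in> layer_elems ls" by (auto simp: layer_elems_def)
  moreover have "{z \<in> layer_elems ls. z div 2 = length ls + 1} = {2 * Suc (length ls)}"
    by (auto simp: layer_elems_def)
  ultimately have "W (2 * length ls) [1] = 1"
    by (simp add: at_height_layered del: mult_Suc_right)
  moreover have "comps 1 = {[1]}"
    by (simp add: comps_rec)
  ultimately show ?case by (simp add: comp_poly_one del: multichains.simps)
next
  case (Suc k)
  let ?i = "length ls - Suc k"
  let ?c = "of_nat (if ls ! ?i = LB then 2 else 1) :: 'k"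
  have i: "?i < length ls" "length ls - k = Suc ?i" using Suc.prems by auto
  have two: "pm_scale 2 vb = (vb + vb :: 'k ab_poly)"
    using pm_scale_add_left[of 1 1 vb] by simp
  have "(\<Sum>p\<in>comps (Suc (Suc k)). pm_scale (of_nat (W (2 * ?i) p)) (comp_poly p)) =
      (\<Sum>p\<in>comps (Suc k). pm_scale (of_nat (W (2 * ?i) (grow_head p))) (comp_poly (grow_head p))
        + pm_scale (of_nat (W (2 * ?i) (1 # p))) (comp_poly (1 # p) :: 'k ab_poly))"
    by (rule sum_comps_Suc) simp
  also have "\<dots> = (\<Sum>p\<in>comps (Suc k).
      (va - vb + pm_scale ?c vb) * pm_scale (of_nat (W (2 * Suc ?i) p)) (comp_poly p))"
  proof (rule sum.cong)
    fix p assume "p \<in> comps (Suc k)"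
    then obtain n q where p: "p = n # q" "1 \<le> n" "composition q"
      by (cases p) (auto simp: comps_def)
    then have "W (2 * ?i) (grow_head p) = W (2 * Suc ?i) p"
      using multichains_layered_grow[of ?i n q] i by (simp del: multichains.simps mult_Suc_right)
    moreover have "W (2 * ?i) (1 # p) = (if ls ! ?i = LB then 2 else 1) * W (2 * Suc ?i) p"
      using p i by (intro multichains_layered_one) auto
    moreover have "comp_poly (grow_head p) = (va - vb) * (comp_poly p :: 'k ab_poly)"
      "comp_poly (1 # p) = vb * (comp_poly p :: 'k ab_poly)"
      using p by (simp_all add: comp_poly_grow comp_poly_one_Cons)
    ultimately show "pm_scale (of_nat (W (2 * ?i) (grow_head p))) (comp_poly (grow_head p))
        + pm_scale (of_nat (W (2 * ?i) (1 # p))) (comp_poly (1 # p)) =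
        (va - vb + pm_scale ?c vb) * pm_scale (of_nat (W (2 * Suc ?i) p)) (comp_poly p :: 'k ab_poly)"
      by (simp only: distrib_right mult_pm_scale_left mult_pm_scale_right pm_scale_scale pm_scale_add of_nat_mult mult.commute)
  qed simp
  also have "\<dots> = (va - vb + pm_scale ?c vb) * layer_product (drop (Suc ?i) ls)"
    using Suc i by (simp only: sum_distrib_left[symmetric])
  also have "\<dots> = layer_product (ls ! ?i # drop (Suc ?i) ls)"
    using two by (cases "ls ! ?i") (simp_all add: algebra_simps del: pm_scale_single)
  also have "ls ! ?i # drop (Suc ?i) ls = drop ?i ls"
    using i by (simp add: Cons_nth_drop_Suc)
  finally show ?case .
qed

lemma ab_index_layered: "ab_index (layered ls) = layer_product ls"
proof -
  have "2 * Suc (length ls) \<in> layer_elems ls" by (simp add: layer_elems_def)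
  then have "poset_rank (layered ls) (2 * Suc (length ls)) = Suc (length ls)"
    using rk_layered by fastforce
  then show ?thesis
    using sum_multichains_layered[of "length ls"]
    by (simp add: layered.ab_index_eq topmost_layered bottom_layered del: mult_Suc_right)
qed

end

text \<open>
  The products of \<open>a\<close> and \<open>a + b\<close> are ab-indices and span. A word is reduced to them letter by
  letter: after a prefix that is such a product, replace \<open>b\<close> by \<open>(a + b) - a\<close>.
\<close>

lemma linear_eq_on_ab_index:
  fixes f g :: "'k::field ab_poly \<Rightarrow> 'b::ab_group_add"
  assumes f: "Vector_Spaces.linear pm_scale s f" and g: "Vector_Spaces.linear pm_scale s g"
    and eq: "\<And>r :: nat rel. graded_poset_pos r \<Longrightarrow> f (ab_index r) = g (ab_index r)"
  shows "f u = g u"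
proof (rule linear_eq_on_words[OF f g])
  have "f (layer_product ls * Poly_Mapping.single w 1) = g (layer_product ls * Poly_Mapping.single w 1)" for ls w
  proof (induction w arbitrary: ls)
    case Nil
    have "f (layer_product ls) = g (layer_product ls)"
      unfolding ab_index_layered[symmetric] by (rule eq[OF graded_poset_pos_layered])
    then show ?case by (simp add: single_Nil)
  next
    case (Cons l w)
    have A: "layer_product ls * (va * Poly_Mapping.single w 1) = layer_product (ls @ [LA]) * Poly_Mapping.single w (1::'k)"
      by (simp add: layer_product_snoc mult.assoc)
    have B: "layer_product ls * (vb * Poly_Mapping.single w 1) = layer_product (ls @ [LB]) * Poly_Mapping.single w (1::'k)
        - layer_product (ls @ [LA]) * Poly_Mapping.single w (1::'k)"
      by (simp add: layer_product_snoc mult.assoc distrib_left distrib_right)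
    show ?case
      by (cases l; subst (1 2) single_Cons)
        (simp_all only: A B linear_map_diff[OF f] linear_map_diff[OF g] Cons.IH)
  qed
  from this[of "[]"] show "f (Poly_Mapping.single w 1) = g (Poly_Mapping.single w 1)" for w by simp
qed

lemma bilinear_eq_on_ab_index:
  assumes "\<And>v. Vector_Spaces.linear pm_scale s (\<lambda>u. f u v)" "\<And>u. Vector_Spaces.linear pm_scale s (f u)"
    and "\<And>v. Vector_Spaces.linear pm_scale s (\<lambda>u. g u v)" "\<And>u. Vector_Spaces.linear pm_scale s (g u)"
    and "\<And>(p :: nat rel) (q :: nat rel). graded_poset_pos p \<Longrightarrow> graded_poset_pos q \<Longrightarrow>
      f (ab_index p) (ab_index q) = g (ab_index p) (ab_index q)"
  shows "f u v = g u v"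
  by (rule linear_eq_on_ab_index[OF assms(1,3)], rule linear_eq_on_ab_index[OF assms(2,4)])
    (rule assms(5))

lemma ab_index_poset_prod:
  assumes "graded_poset_pos r" "graded_poset_pos s"
  shows "ab_index (poset_prod r s) = shuffle (ab_index r) (ab_index s)"
proof -
  interpret graded_pair r s
    using assms by unfold_locales (simp_all add: graded_poset_pos_def)
  show ?thesis using assms by (intro ab_index_prod) (simp_all add: graded_poset_pos_def)
qed

text \<open>
  The product formula shows that the quasi-shuffle product is a candidate for \<^const>\<open>mix\<close>;
  spanning shows that it is the only one.
\<close>

theorem mix_eq_shuffle: "mix = (shuffle :: 'k::field ab_poly \<Rightarrow> _)"
  unfolding mix_def
proof (rule the_equality)
  fix M :: "'k ab_poly \<Rightarrow> 'k ab_poly \<Rightarrow> 'k ab_poly"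
  assume M: "(\<forall>u. plinear (M u)) \<and> (\<forall>v. plinear (\<lambda>u. M u v)) \<and>
    (\<forall>(r :: nat rel) (s :: nat rel). graded_poset_pos r \<longrightarrow> graded_poset_pos s \<longrightarrow>
       ab_index (poset_prod r s) = M (ab_index r) (ab_index s))"
  have "M u v = shuffle u v" for u v
  proof (rule bilinear_eq_on_ab_index[where f = M and g = shuffle and s = pm_scale])
    show "M (ab_index r) (ab_index s) = shuffle (ab_index r) (ab_index s)"
      if "graded_poset_pos r" "graded_poset_pos s" for r s :: "nat rel"
      using M that by (simp add: ab_index_poset_prod[symmetric])
  qed (simp_all add: M linear_shuffle_left linear_shuffle_right)
  then show "M = shuffle" by blast
qed (simp add: linear_shuffle_left linear_shuffle_right ab_index_poset_prod)

lemma linear_character: "ab_character G \<Longrightarrow> Vector_Spaces.linear pm_scale (*) G"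
  by (simp add: ab_character_def)

lemma linear_times: "Vector_Spaces.linear pm_scale (*) G \<Longrightarrow> Vector_Spaces.linear pm_scale (*) (\<lambda>u. c * G u)"
  "Vector_Spaces.linear pm_scale (*) G \<Longrightarrow> Vector_Spaces.linear pm_scale (*) (\<lambda>u. G u * c)"
  for c :: "'k::field"
  by (simp_all add: Vector_Spaces.linear_iff distrib_left distrib_right mult_ac)

lemma character_shuffle:
  assumes "ab_character G"
  shows "G (shuffle u v) = G u * G v"
proof (rule bilinear_eq_on_ab_index[where f = "\<lambda>u v. G (shuffle u v)" and g = "\<lambda>u v. G u * G v" and s = "(*)"])
  note G = linear_character[OF assms]
  show "Vector_Spaces.linear pm_scale (*) (\<lambda>u. G (shuffle u v))"
    "Vector_Spaces.linear pm_scale (*) (\<lambda>v. G (shuffle u v))" for u v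
    using linear_compose[OF linear_shuffle_left G] linear_compose[OF linear_shuffle_right G] by blast+
  show "Vector_Spaces.linear pm_scale (*) (\<lambda>u. G u * G v)"
    "Vector_Spaces.linear pm_scale (*) (\<lambda>v. G u * G v)" for u v
    using linear_times[OF G] by blast+
  show "G (shuffle (ab_index p) (ab_index q)) = G (ab_index p) * G (ab_index q)"
    if "graded_poset_pos p" "graded_poset_pos q" for p q :: "nat rel"
    using assms that by (simp add: ab_character_def ab_index_poset_prod[symmetric])
qed

section \<open>The coproduct on the basis is deconcatenation\<close>

text \<open>
  The image of the coproduct of \<open>u\<close> under the linear map on the tensor square that is induced by
  the bilinear map \<open>B\<close>.
\<close>

definition coprod_apply :: "('k::field ab_poly \<Rightarrow> 'k ab_poly \<Rightarrow> 'k ab_poly) \<Rightarrow> 'k ab_poly \<Rightarrow> 'k ab_poly" where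
  "coprod_apply B u = lin_ext (\<lambda>(w, w'). B (Poly_Mapping.single w 1) (Poly_Mapping.single w' 1)) (coprod u)"

lemma linear_coprod: "plinear coprod"
  by (simp add: coprod_def linear_lin_ext)

lemma linear_coprod_apply: "plinear (coprod_apply B)"
  unfolding coprod_apply_def[abs_def] by (rule linear_compose[OF linear_coprod linear_lin_ext])

lemma coprod_apply_one: "coprod_apply B 1 = 0"
  by (simp add: coprod_apply_def coprod_def single_Nil[symmetric])

text \<open>
  The coproduct is a derivation whose value at a letter is \<open>1 \<otimes> 1\<close>.
\<close>

lemma coprod_apply_letter:
  fixes B :: "'k::field ab_poly \<Rightarrow> 'k ab_poly \<Rightarrow> 'k ab_poly"
  assumes B: "\<And>x. plinear (B x)"
  shows "coprod_apply B (Poly_Mapping.single [l] 1 * u) =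
    B 1 u + coprod_apply (\<lambda>x. B (Poly_Mapping.single [l] 1 * x)) u"
proof (rule linear_eq_on_words[where s = pm_scale and u = u and f = "\<lambda>u. coprod_apply B (Poly_Mapping.single [l] 1 * u)"
      and g = "\<lambda>u. B 1 u + coprod_apply (\<lambda>x. B (Poly_Mapping.single [l] 1 * x)) u"])
  show "plinear (\<lambda>u. coprod_apply B (Poly_Mapping.single [l] 1 * u))"
    by (rule linear_compose[OF linear_mult_left linear_coprod_apply])
  show "plinear (\<lambda>u. B 1 u + coprod_apply (\<lambda>x. B (Poly_Mapping.single [l] 1 * x)) u)"
    by (rule plinearI) (simp_all add: linear_map_add[OF B] linear_map_scale[OF B]
        linear_map_add[OF linear_coprod_apply] linear_map_scale[OF linear_coprod_apply] pm_scale_add)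
  show "coprod_apply B (Poly_Mapping.single [l] 1 * Poly_Mapping.single w 1) =
      B 1 (Poly_Mapping.single w 1) +
      coprod_apply (\<lambda>x. B (Poly_Mapping.single [l] 1 * x)) (Poly_Mapping.single w 1)" for w
    unfolding single_Cons[symmetric]
    by (simp add: coprod_apply_def coprod_def linear_map_sum[OF linear_lin_ext] single_Nil[symmetric]
        single_Cons[symmetric] sum.lessThan_Suc_shift lin_ext_add del: sum.lessThan_Suc)
qed

lemma pm_scale_diff: "pm_scale c (u - v) = pm_scale c u - pm_scale c v"
  by (rule poly_mapping_eqI) (simp add: lookup_minus algebra_simps)

text \<open>
  The contributions \<open>1 \<otimes> 1\<close> of \<open>a\<close> and \<open>b\<close> cancel in \<open>a - b\<close>, so the coproduct
  cuts a basis element only at the letters \<open>b\<close> that separate its parts.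
\<close>

lemma coprod_comp_poly:
  fixes B :: "'k::field ab_poly \<Rightarrow> 'k ab_poly \<Rightarrow> 'k ab_poly"
  assumes "composition p" "p \<noteq> []"
    and "\<And>y. plinear (\<lambda>x. B x y)" "\<And>x. plinear (B x)"
  shows "coprod_apply B (comp_poly p) =
    (\<Sum>i\<in>{1..<length p}. B (comp_poly (take i p)) (comp_poly (drop i p)))"
  using assms
proof (induction p arbitrary: B rule: composition_induct)
  case one
  then show ?case by (simp add: comp_poly_one coprod_apply_one)
next
  case (grow n qs)
  note B = grow.prems
  let ?B = "\<lambda>x. B ((va - vb) * x)"
  have "coprod_apply B (comp_poly (Suc n # qs)) =
      coprod_apply B (va * comp_poly (n # qs)) - coprod_apply B (vb * comp_poly (n # qs))"
    using grow.hyps by (simp add: comp_poly_grow left_diff_distrib linear_map_diff[OF linear_coprod_apply])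
  also have "\<dots> = coprod_apply (\<lambda>x. B (va * x)) (comp_poly (n # qs)) - coprod_apply (\<lambda>x. B (vb * x)) (comp_poly (n # qs))"
    by (simp add: coprod_apply_letter[OF B(2)])
  also have "\<dots> = coprod_apply ?B (comp_poly (n # qs))"
    by (simp add: coprod_apply_def lin_ext_def sum_subtractf[symmetric]
        case_prod_unfold pm_scale_diff[symmetric] left_diff_distrib linear_map_diff[OF B(1)])
  also have "\<dots> = (\<Sum>i\<in>{1..<length (n # qs)}. ?B (comp_poly (take i (n # qs))) (comp_poly (drop i (n # qs))))"
    by (rule grow.IH[of ?B]) (intro linear_compose[OF linear_mult_left B(1)] B(2))+
  also have "\<dots> = (\<Sum>i\<in>{1..<length (n # qs)}. B (comp_poly (take i (Suc n # qs))) (comp_poly (drop i (Suc n # qs))))"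
    using grow.hyps by (intro sum.cong refl) (auto simp: take_Cons' drop_Cons' comp_poly_grow)
  finally show ?case by simp
next
  case (one_Cons qs)
  note B = one_Cons.prems
  let ?B = "\<lambda>x. B (vb * x)"
  have "coprod_apply B (comp_poly (1 # qs)) = B 1 (comp_poly qs) + coprod_apply ?B (comp_poly qs)"
    using one_Cons.hyps by (simp add: comp_poly_one_Cons coprod_apply_letter[OF B(2)])
  also have "coprod_apply ?B (comp_poly qs) =
      (\<Sum>i\<in>{1..<length qs}. ?B (comp_poly (take i qs)) (comp_poly (drop i qs)))"
    by (rule one_Cons.IH[of ?B]) (intro linear_compose[OF linear_mult_left B(1)] B(2))+
  also have "\<dots> = (\<Sum>i\<in>{1..<length qs}. B (comp_poly (1 # take i qs)) (comp_poly (drop i qs)))"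
    using one_Cons.hyps by (intro sum.cong refl) (auto simp: comp_poly_one_Cons)
  also have "B 1 (comp_poly qs) + \<dots> =
      (\<Sum>i\<in>{0..<length qs}. B (comp_poly (1 # take i qs)) (comp_poly (drop i qs)))"
    using one_Cons.hyps by (simp add: sum.atLeast_Suc_lessThan[of 0] comp_poly_one)
  also have "\<dots> = (\<Sum>i\<in>{Suc 0..<Suc (length qs)}. B (comp_poly (take i (1 # qs))) (comp_poly (drop i (1 # qs))))"
    by (simp only: sum.shift_bounds_Suc_ivl take_Suc_Cons drop_Suc_Cons)
  finally show ?case by simp
qed


section \<open>The chain map of the second kind on the basis\<close>

lemma linear_ghat: "plinear (ghat G)"
  by (simp add: ghat_def linear_lin_ext)

lemma keys_mult_letter:
  "Poly_Mapping.keys (Poly_Mapping.single [l] 1 * (u :: 'k::field ab_poly)) \<subseteq> (#) l ` Poly_Mapping.keys u"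
  using keys_mult[of "Poly_Mapping.single [l] (1::'k)" u] by (auto simp: plus_list_def)

text \<open>
  Homogeneity, which makes \<^const>\<open>ghat\<close> explicit on the basis.
\<close>

lemma keys_comp_poly:
  "composition p \<Longrightarrow> p \<noteq> [] \<Longrightarrow> w \<in> Poly_Mapping.keys (comp_poly p :: 'k::field ab_poly) \<Longrightarrow>
    length w = sum_list p - 1"
proof (induction p arbitrary: w rule: composition_induct)
  case one
  then show ?case by (simp add: comp_poly_one single_Nil[symmetric])
next
  case (grow n qs)
  have "w \<in> Poly_Mapping.keys (va * (comp_poly (n # qs) :: 'k ab_poly)) \<union> Poly_Mapping.keys (vb * (comp_poly (n # qs) :: 'k ab_poly))"
    using grow.prems grow.hyps by (auto simp: comp_poly_grow left_diff_distrib in_keys_iff lookup_minus)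
  then obtain w' where "w' \<in> Poly_Mapping.keys (comp_poly (n # qs) :: 'k ab_poly)" "length w = Suc (length w')"
    using keys_mult_letter[of _ "comp_poly (n # qs) :: 'k ab_poly"] by fastforce
  then show ?case using grow.IH[of w'] grow.hyps by simp
next
  case (one_Cons qs)
  then obtain w' where "w' \<in> Poly_Mapping.keys (comp_poly qs :: 'k ab_poly)" "length w = Suc (length w')"
    using keys_mult_letter[of LB "comp_poly qs :: 'k ab_poly"] by (fastforce simp: comp_poly_one_Cons)
  moreover have "0 < sum_list qs"
    using one_Cons.hyps by (cases qs) auto
  ultimately show ?case using one_Cons.IH[of w'] by simp
qed

lemma ghat_comp_poly:
  fixes G :: "'k::field ab_poly \<Rightarrow> 'k"
  assumes G: "Vector_Spaces.linear pm_scale (*) G" and p: "composition p" "p \<noteq> []"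
  shows "ghat G (comp_poly p) = pm_scale (G (comp_poly p)) ((va - vb) ^ (sum_list p - 1))"
proof -
  let ?u = "comp_poly p :: 'k ab_poly"
  have "ghat G ?u = pm_scale (\<Sum>w\<in>Poly_Mapping.keys ?u. Poly_Mapping.lookup ?u w * G (Poly_Mapping.single w 1))
      ((va - vb) ^ (sum_list p - 1))"
    by (simp add: ghat_def lin_ext_def pm_scale_sum_left keys_comp_poly[OF p])
  also have "(\<Sum>w\<in>Poly_Mapping.keys ?u. Poly_Mapping.lookup ?u w * G (Poly_Mapping.single w 1)) = G ?u"
    using linear_of_lin_ext[OF G, of "\<lambda>w. Poly_Mapping.single w 1" ?u] by (simp add: lin_ext_id)
  finally show ?thesis .
qed

definition gtilde_part :: "('k::field ab_poly \<Rightarrow> 'k) \<Rightarrow> nat \<Rightarrow> 'k ab_poly \<Rightarrow> 'k ab_poly" where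
  "gtilde_part G k u =
    lin_ext (\<lambda>ws. join_b (map (\<lambda>w. ghat G (Poly_Mapping.single w 1)) ws)) (coprod_into k u)"

lemma linear_coprod_into: "plinear (coprod_into k :: 'k::field ab_poly \<Rightarrow> _)"
proof (cases "(k, undefined :: 'k ab_poly)" rule: coprod_into.cases)
  case (1 u)
  then show ?thesis by (auto intro: plinearI)
next
  case (2 u)
  then show ?thesis by (auto intro: plinearI simp: lin_ext_add lin_ext_scale)
next
  case (3 k u)
  then show ?thesis
    by (auto intro!: plinearI simp: lin_ext_add lin_ext_scale linear_map_add[OF linear_coprod] linear_map_scale[OF linear_coprod])
qed

lemma linear_gtilde_part: "plinear (gtilde_part G k)"
  unfolding gtilde_part_def[abs_def] by (rule linear_compose[OF linear_coprod_into linear_lin_ext])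

lemma gtilde_part_1: "gtilde_part G (Suc 0) u = ghat G u"
proof -
  have "gtilde_part G (Suc 0) u = lin_ext (\<lambda>w. ghat G (Poly_Mapping.single w 1)) u"
    by (simp add: gtilde_part_def linear_comp_lin_ext[OF linear_lin_ext])
  then show ?thesis by (simp add: linear_comp_lin_ext[OF linear_ghat, symmetric] lin_ext_id)
qed

lemma keys_coprod_into: "ws \<in> Poly_Mapping.keys (coprod_into (Suc k) u) \<Longrightarrow> ws \<noteq> []"
  by (cases k) (auto elim!: lin_ext_keysE simp: tensor_cons_def split: if_splits)

lemma gtilde_part_Suc:
  "gtilde_part G (Suc (Suc k)) u = coprod_apply (\<lambda>x y. ghat G x * vb * gtilde_part G (Suc k) y) u"
proof -
  let ?j = "\<lambda>ws. join_b (map (\<lambda>w. ghat G (Poly_Mapping.single w 1)) ws)"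
  have "lin_ext ?j (tensor_cons w (coprod_into (Suc k) v)) =
      ghat G (Poly_Mapping.single w 1) * vb * gtilde_part G (Suc k) v" for w v
  proof -
    have "lin_ext ?j (tensor_cons w (coprod_into (Suc k) v)) = lin_ext (\<lambda>ws. ?j (w # ws)) (coprod_into (Suc k) v)"
      by (simp add: tensor_cons_def linear_comp_lin_ext[OF linear_lin_ext])
    also have "\<dots> = lin_ext (\<lambda>ws. ghat G (Poly_Mapping.single w 1) * vb * ?j ws) (coprod_into (Suc k) v)"
    proof (rule lin_ext_cong)
      fix ws assume "ws \<in> Poly_Mapping.keys (coprod_into (Suc k) v)"
      then have "ws \<noteq> []" by (rule keys_coprod_into)
      then show "?j (w # ws) = ghat G (Poly_Mapping.single w 1) * vb * ?j ws" by (cases ws) simp_all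
    qed
    also have "\<dots> = ghat G (Poly_Mapping.single w 1) * vb * gtilde_part G (Suc k) v"
      by (simp add: gtilde_part_def linear_comp_lin_ext[OF linear_mult_left])
    finally show ?thesis .
  qed
  then show ?thesis
    by (simp add: gtilde_part_def[of G "Suc (Suc k)"] coprod_apply_def linear_comp_lin_ext[OF linear_lin_ext]
        case_prod_unfold)
qed

lemma gtilde_part_Suc_comp_poly:
  assumes "composition p" "p \<noteq> []"
  shows "gtilde_part G (Suc (Suc k)) (comp_poly p) =
    (\<Sum>i\<in>{1..<length p}. ghat G (comp_poly (take i p)) * vb * gtilde_part G (Suc k) (comp_poly (drop i p)))"
  unfolding gtilde_part_Suc using assms
  by (intro coprod_comp_poly linear_compose[OF linear_gtilde_part linear_mult_left])
    (auto intro!: plinearI simp: linear_map_add[OF linear_ghat] linear_map_scale[OF linear_ghat] distrib_right)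

lemma composition_take_drop: "composition p \<Longrightarrow> composition (take i p) \<and> composition (drop i p)"
  by (metis append_take_drop_id composition_append)

text \<open>
  A composition cannot be cut into more nonempty blocks than it has parts.
\<close>

lemma gtilde_part_eq_0:
  "composition p \<Longrightarrow> p \<noteq> [] \<Longrightarrow> length p \<le> k \<Longrightarrow> gtilde_part G (Suc k) (comp_poly p) = 0"
proof (induction k arbitrary: p)
  case (Suc k)
  then show ?case by (auto simp: gtilde_part_Suc_comp_poly composition_take_drop intro!: sum.neutral)
qed simp

lemma gtilde_eq_sum:
  assumes "\<And>k. N < k \<Longrightarrow> gtilde_part G k u = 0"
  shows "gtilde G u = (\<Sum>k=1..N. gtilde_part G k u)"
proof -
  have "gtilde G u = Sum_any (\<lambda>k. if 1 \<le> k then gtilde_part G k u else 0)"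
    by (simp add: gtilde_def gtilde_part_def cong: if_cong)
  also have "\<dots> = (\<Sum>k=1..N. if 1 \<le> k then gtilde_part G k u else 0)"
    by (rule Sum_any.expand_superset) (use assms in \<open>auto simp: not_less[symmetric]\<close>)
  finally show ?thesis by simp
qed

text \<open>
  Hence the sum over all \<open>k\<close> that defines \<^const>\<open>gtilde\<close> is finite, and \<^const>\<open>gtilde\<close> is linear.
\<close>

lemma gtilde_part_eventually_0: "\<exists>N. \<forall>k>N. gtilde_part G k u = 0"
proof (intro exI allI impI)
  (* the sum of the lengths is a bound for each of them *)
  fix k assume k: "(\<Sum>p\<in>Poly_Mapping.keys (coords u). length p) < k"
  have "gtilde_part G k (comp_poly p) = 0" if p: "p \<in> Poly_Mapping.keys (coords u)" for p
  proof -
    have "length p \<le> (\<Sum>p\<in>Poly_Mapping.keys (coords u). length p)"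
      by (rule member_le_sum[OF p]) simp_all
    then show ?thesis using coords_keys[OF p] k gtilde_part_eq_0[of p "k - 1" G] by (cases k) auto
  qed
  then have "gtilde_part G k (lin_ext comp_poly (coords u)) = 0"
    by (simp add: linear_of_lin_ext[OF linear_gtilde_part])
  then show "gtilde_part G k u = 0" by (simp add: comp_poly_coords)
qed

lemma linear_gtilde: "plinear (gtilde G)" for G :: "'k::field ab_poly \<Rightarrow> 'k"
proof (rule plinearI)
  fix u v :: "'k ab_poly" and c :: 'k
  obtain N N' where N: "\<And>k. N < k \<Longrightarrow> gtilde_part G k u = 0" "\<And>k. N' < k \<Longrightarrow> gtilde_part G k v = 0"
    using gtilde_part_eventually_0 by metis
  then have "gtilde G u = (\<Sum>k=1..max N N'. gtilde_part G k u)" "gtilde G v = (\<Sum>k=1..max N N'. gtilde_part G k v)"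
    "gtilde G (u + v) = (\<Sum>k=1..max N N'. gtilde_part G k (u + v))"
    by (intro gtilde_eq_sum; simp add: linear_map_add[OF linear_gtilde_part])+
  then show "gtilde G (u + v) = gtilde G u + gtilde G v"
    by (simp add: linear_map_add[OF linear_gtilde_part] sum.distrib)
  have "gtilde G (pm_scale c u) = (\<Sum>k=1..N. gtilde_part G k (pm_scale c u))"
    by (intro gtilde_eq_sum) (simp add: linear_map_scale[OF linear_gtilde_part] N)
  then show "gtilde G (pm_scale c u) = pm_scale c (gtilde G u)"
    by (simp add: gtilde_eq_sum[OF N(1)] linear_map_scale[OF linear_gtilde_part] pm_scale_sum)
qed

text \<open>
  Separating the first block turns the sum over \<open>k\<close> into a recursion.
\<close>

lemma gtilde_comp_poly_rec:
  assumes p: "composition p" "p \<noteq> []"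
  shows "gtilde G (comp_poly p) = ghat G (comp_poly p) +
    (\<Sum>i\<in>{1..<length p}. ghat G (comp_poly (take i p)) * vb * gtilde G (comp_poly (drop i p)))"
proof -
  obtain n where n: "length p = Suc n" using p(2) by (cases p) auto
  have vanish: "gtilde_part G k (comp_poly (drop i p)) = 0" if "i < length p" "length p - i < k" for i k
    using that p gtilde_part_eq_0[of "drop i p" "k - 1" G] composition_take_drop[OF p(1), of i] by (cases k) auto
  have "gtilde G (comp_poly p) = (\<Sum>k=1..Suc n. gtilde_part G k (comp_poly p))"
    using vanish[of 0] by (intro gtilde_eq_sum) (simp add: n)
  also have "\<dots> = ghat G (comp_poly p) + (\<Sum>k=1..n. gtilde_part G (Suc k) (comp_poly p))"
    by (subst sum.atLeast_Suc_atMost) (simp, simp only: One_nat_def gtilde_part_1 sum.shift_bounds_cl_Suc_ivl)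
  also have "(\<Sum>k=1..n. gtilde_part G (Suc k) (comp_poly p)) = (\<Sum>k=1..n. \<Sum>i\<in>{1..<length p}.
      ghat G (comp_poly (take i p)) * vb * gtilde_part G k (comp_poly (drop i p)))"
  proof (rule sum.cong)
    fix k assume "k \<in> {1..n}"
    then show "gtilde_part G (Suc k) (comp_poly p) = (\<Sum>i\<in>{1..<length p}.
        ghat G (comp_poly (take i p)) * vb * gtilde_part G k (comp_poly (drop i p)))"
      using gtilde_part_Suc_comp_poly[OF p, of G "k - 1"] by simp
  qed simp
  also have "\<dots> = (\<Sum>i\<in>{1..<length p}. ghat G (comp_poly (take i p)) * vb *
      (\<Sum>k=1..n. gtilde_part G k (comp_poly (drop i p))))"
    by (simp only: sum_distrib_left) (rule sum.swap)
  also have "\<dots> = (\<Sum>i\<in>{1..<length p}. ghat G (comp_poly (take i p)) * vb * gtilde G (comp_poly (drop i p)))"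
    by (intro sum.cong refl arg_cong2[where f = "(*)"] gtilde_eq_sum[symmetric] vanish) (auto simp: n)
  finally show ?thesis .
qed

text \<open>
  The sum, over all ways of cutting \<open>p\<close> into consecutive, possibly empty blocks with sums
  \<open>ns\<close>, of the products of the values of \<open>f\<close> at the blocks. For the functional
  \<open>basis_value G\<close> below, these are the coordinates of \<open>gtilde G (comp_poly p)\<close>.
\<close>

fun block_coeff :: "(nat list \<Rightarrow> 'k::field) \<Rightarrow> nat list \<Rightarrow> nat list \<Rightarrow> 'k" where
  "block_coeff f p [] = (if p = [] then 1 else 0)"
| "block_coeff f p (n # ns) =
    (\<Sum>i\<le>length p. if sum_list (take i p) = n then f (take i p) * block_coeff f (drop i p) ns else 0)"

text \<open>
  The value 1 at the empty composition extends \<open>G\<close> to a unital functional on all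
  quasisymmetric functions, and makes empty blocks harmless.
\<close>

definition basis_value :: "('k::field ab_poly \<Rightarrow> 'k) \<Rightarrow> nat list \<Rightarrow> 'k" where
  "basis_value G p = (if p = [] then 1 else G (comp_poly p))"

lemma sum_list_take_drop: "sum_list (take i p) + sum_list (drop i p) = (sum_list p :: nat)"
  by (metis append_take_drop_id sum_list_append)

lemma composition_sum_list_0: "composition p \<Longrightarrow> sum_list p = 0 \<longleftrightarrow> p = []"
  by (cases p) auto

lemma block_coeff_eq_0: "sum_list p \<noteq> sum_list ns \<Longrightarrow> block_coeff f p ns = 0"
proof (induction ns arbitrary: p)
  case (Cons n ns)
  have "block_coeff f (drop i p) ns = 0" if "sum_list (take i p) = n" for i
    using that Cons.prems sum_list_take_drop[of i p] by (intro Cons.IH) auto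
  then show ?case by (auto intro!: sum.neutral)
qed auto

lemma block_coeff_nonzero_parts:
  assumes "f [] = 1"
  shows "composition p \<Longrightarrow> block_coeff f p (nonzero_parts ns) = block_coeff f p ns"
proof (induction ns arbitrary: p)
  case (Cons n ns)
  have IH: "block_coeff f (drop i p) (nonzero_parts ns) = block_coeff f (drop i p) ns" for i
    using Cons composition_take_drop by blast
  show ?case
  proof (cases "n = 0")
    case True
    have "block_coeff f p (0 # ns) = (\<Sum>i\<le>length p. if i = 0 then block_coeff f p ns else 0)"
      unfolding block_coeff.simps
    proof (rule sum.cong)
      fix i assume "i \<in> {..length p}"
      have "sum_list (take i p) = 0 \<longleftrightarrow> take i p = []"
        using Cons.prems composition_take_drop[of p i] by (intro composition_sum_list_0) blast
      then show "(if sum_list (take i p) = 0 then f (take i p) * block_coeff f (drop i p) ns else 0) =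
          (if i = 0 then block_coeff f p ns else 0)"
        using \<open>i \<in> _\<close> assms by auto
    qed simp
    then show ?thesis using True IH[of 0] by simp
  next
    case False
    then show ?thesis by (simp add: IH cong: if_cong)
  qed
qed simp

text \<open>
  Induction along the recursion for \<^const>\<open>gtilde\<close>. The sum over the first part \<open>n\<close> of
  \<open>s\<close> is matched with the sum over the length \<open>i\<close> of the first block, since that block has sum \<open>n\<close>;
  no empty block occurs, as the parts of \<open>s\<close> are positive.
\<close>

lemma gtilde_comp_poly:
  assumes G: "Vector_Spaces.linear pm_scale (*) G"
  shows "composition p \<Longrightarrow> p \<noteq> [] \<Longrightarrow> gtilde G (comp_poly p) =
    (\<Sum>s\<in>comps (sum_list p). pm_scale (block_coeff (basis_value G) p s) (comp_poly s))"
proof (induction p rule: length_induct)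
  case (1 p)
  let ?S = "sum_list p" and ?f = "basis_value G"
  let ?t = "\<lambda>i. sum_list (take i p)"
  have S: "0 < ?S" using 1 composition_sum_list_0 by blast
  have t: "?t i \<in> {1..?S}" if "i \<in> {1..length p}" for i
  proof -
    have "take i p \<noteq> []" "composition (take i p)"
      using that 1 composition_take_drop[of p i] by auto
    then have "?t i \<noteq> 0" using composition_sum_list_0 by blast
    then show ?thesis
      using sum_list_take_drop[of i p] by (simp only: atLeastAtMost_iff) linarith
  qed
  have block: "(\<Sum>s\<in>comps (sum_list (drop i p)).
        pm_scale (?f (take i p) * block_coeff ?f (drop i p) s) (comp_poly (?t i # s))) =
      ghat G (comp_poly (take i p)) * vb * gtilde G (comp_poly (drop i p))"
    if i: "i \<in> {1..<length p}" for i
  proof -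
    have c: "composition (take i p)" "composition (drop i p)" "take i p \<noteq> []" "drop i p \<noteq> []"
      using i 1 composition_take_drop[of p i] by auto
    then have "s \<noteq> []" if "s \<in> comps (sum_list (drop i p))" for s
      using that composition_sum_list_0[of "drop i p"] by (auto simp: comps_def)
    then have "(\<Sum>s\<in>comps (sum_list (drop i p)).
        pm_scale (?f (take i p) * block_coeff ?f (drop i p) s) (comp_poly (?t i # s))) =
      (\<Sum>s\<in>comps (sum_list (drop i p)). ghat G (comp_poly (take i p)) * vb *
        pm_scale (block_coeff ?f (drop i p) s) (comp_poly s))"
      using c by (intro sum.cong refl) (simp add: comp_poly_Cons ghat_comp_poly[OF G] basis_value_def mult.commute)
    also have "\<dots> = ghat G (comp_poly (take i p)) * vb * gtilde G (comp_poly (drop i p))"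
      using 1 i c by (simp add: sum_distrib_left)
    finally show ?thesis .
  qed
  have "(\<Sum>s\<in>comps ?S. pm_scale (block_coeff ?f p s) (comp_poly s)) =
      (\<Sum>n\<in>{1..?S}. \<Sum>s\<in>comps (?S - n). \<Sum>i\<in>{0..length p}.
        pm_scale (if ?t i = n then ?f (take i p) * block_coeff ?f (drop i p) s else 0) (comp_poly (n # s)))"
    by (simp add: sum_comps_rec[OF S] pm_scale_sum_left atMost_atLeast0)
  also have "\<dots> = (\<Sum>i\<in>{0..length p}. \<Sum>n\<in>{1..?S}. if ?t i = n then \<Sum>s\<in>comps (?S - n).
        pm_scale (?f (take i p) * block_coeff ?f (drop i p) s) (comp_poly (n # s)) else 0)"
    by (simp only: sum.swap[of _ "{0..length p}"]) (intro sum.cong refl, auto)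
  also have "\<dots> = (\<Sum>i\<in>{1..length p}. \<Sum>n\<in>{1..?S}. if ?t i = n then \<Sum>s\<in>comps (?S - n).
        pm_scale (?f (take i p) * block_coeff ?f (drop i p) s) (comp_poly (n # s)) else 0)"
    by (rule sum.mono_neutral_right) (auto simp: Suc_le_eq)
  also have "\<dots> = (\<Sum>i\<in>{1..length p}. \<Sum>s\<in>comps (sum_list (drop i p)).
        pm_scale (?f (take i p) * block_coeff ?f (drop i p) s) (comp_poly (?t i # s)))"
  proof (rule sum.cong)
    fix i assume i: "i \<in> {1..length p}"
    have "?S - ?t i = sum_list (drop i p)" using sum_list_take_drop[of i p] by simp
    then show "(\<Sum>n\<in>{1..?S}. if ?t i = n then \<Sum>s\<in>comps (?S - n).
          pm_scale (?f (take i p) * block_coeff ?f (drop i p) s) (comp_poly (n # s)) else 0) =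
        (\<Sum>s\<in>comps (sum_list (drop i p)).
          pm_scale (?f (take i p) * block_coeff ?f (drop i p) s) (comp_poly (?t i # s)))"
      using t[OF i] by (simp add: sum.delta' del: atLeastAtMost_iff)
  qed simp
  also have "{1..length p} = insert (length p) {1..<length p}"
    using 1 by (auto simp: Suc_le_eq)
  also have "(\<Sum>i\<in>insert (length p) {1..<length p}. \<Sum>s\<in>comps (sum_list (drop i p)).
        pm_scale (?f (take i p) * block_coeff ?f (drop i p) s) (comp_poly (?t i # s))) =
      ghat G (comp_poly p) +
      (\<Sum>i\<in>{1..<length p}. ghat G (comp_poly (take i p)) * vb * gtilde G (comp_poly (drop i p)))"
    using 1 by (simp add: block ghat_comp_poly[OF G] comp_poly_single basis_value_def[of G p] del: One_nat_def)
  also have "\<dots> = gtilde G (comp_poly p)"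
    using 1 by (simp add: gtilde_comp_poly_rec)
  finally show ?case by simp
qed

section \<open>Multiplicativity of the chain map\<close>

text \<open>
  Cutting a composition of \<open>N\<close> after an initial block of sum \<open>n\<close> is a bijection onto
  pairs of compositions of \<open>n\<close> and \<open>N - n\<close>.
\<close>

lemma sum_comps_cut:
  "(\<Sum>r\<in>comps N. \<Sum>i\<le>length r. if sum_list (take i r) = n then h (take i r) (drop i r) else 0) =
    (if n \<le> N then \<Sum>a\<in>comps n. \<Sum>b\<in>comps (N - n). h a b else (0 :: 'b::comm_monoid_add))"
proof (cases "n \<le> N")
  case True
  have "(\<Sum>r\<in>comps N. \<Sum>i\<le>length r. if sum_list (take i r) = n then h (take i r) (drop i r) else 0) =
      (\<Sum>r\<in>comps N. \<Sum>i\<in>{i. i \<le> length r \<and> sum_list (take i r) = n}. h (take i r) (drop i r))"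
    by (intro sum.cong refl sum.mono_neutral_cong_right) auto
  also have "\<dots> = (\<Sum>(r, i)\<in>Sigma (comps N) (\<lambda>r. {i. i \<le> length r \<and> sum_list (take i r) = n}). h (take i r) (drop i r))"
    by (rule sum.Sigma) auto
  also have "\<dots> = (\<Sum>(a, b)\<in>comps n \<times> comps (N - n). h a b)"
  proof (rule sum.reindex_bij_witness[where i = "\<lambda>(a, b). (a @ b, length a)" and j = "\<lambda>(r, i). (take i r, drop i r)"])
    show "(case z of (r, i) \<Rightarrow> (take i r, drop i r)) \<in> comps n \<times> comps (N - n)"
      if "z \<in> Sigma (comps N) (\<lambda>r. {i. i \<le> length r \<and> sum_list (take i r) = n})" for z
    proof -
      obtain r i where z: "z = (r, i)" by (cases z)
      then show ?thesis
        using that sum_list_take_drop[of i r] composition_take_drop[of r i] by (auto simp: comps_def)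
    qed
  qed (use True in \<open>auto simp: comps_def\<close>)
  finally show ?thesis using True by (simp add: sum.cartesian_product)
next
  case False
  have "sum_list (take i r) \<noteq> n" if "r \<in> comps N" for r i
    using that False sum_list_take_drop[of i r] by (auto simp: comps_def)
  then show ?thesis using False by (simp cong: if_cong)
qed

text \<open>
  The heart of the matter: if \<open>f\<close> is multiplicative for the quasi-shuffle product, so are the
  block coefficients at any exponent list. Cutting off the first block of \<open>r\<close> deconcatenates
  \<open>p\<close> and \<open>q\<close> as well; multiplicativity of \<open>f\<close> treats the first blocks, and the induction hypothesis
  treats the rest.
\<close>

lemma block_coeff_shuffle:
  fixes f :: "nat list \<Rightarrow> 'k::field"
  assumes f: "\<And>p q. composition p \<Longrightarrow> composition q \<Longrightarrow>
    (\<Sum>r\<in>comps (sum_list p + sum_list q). shuffle_coeff p q r * f r) = f p * f q"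
  shows "composition p \<Longrightarrow> composition q \<Longrightarrow>
    (\<Sum>r\<in>comps (sum_list p + sum_list q). shuffle_coeff p q r * block_coeff f r s) =
    (\<Sum>(is, js)\<in>list_splits s. block_coeff f p is * block_coeff f q js)"
proof (induction s arbitrary: p q)
  case Nil
  show ?case
  proof (cases "p = [] \<and> q = []")
    case True
    then show ?thesis by (simp add: shuffle_coeff_def monomial_coeff_def)
  next
    case False
    then have "sum_list p + sum_list q \<noteq> 0"
      using Nil composition_sum_list_0 by (metis add_is_0)
    then have "r \<noteq> []" if "r \<in> comps (sum_list p + sum_list q)" for r
      using that by (auto simp: comps_def)
    then show ?thesis using False by (auto intro!: sum.neutral)
  qed
next
  case (Cons n s)
  let ?N = "sum_list p + sum_list q" and ?K = "block_coeff f"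
  let ?p = "\<lambda>i. sum_list (take i p)" and ?q = "\<lambda>j. sum_list (take j q)"
  let ?S = "\<lambda>i j. (\<Sum>(is, js)\<in>list_splits s. ?K (drop i p) is * ?K (drop j q) js)"
  (* for degree reasons, a first block of sum n comes only from first blocks of p and q whose
     sums add up to n *)
  have part: "(\<Sum>a\<in>comps n. shuffle_coeff (take i p) (take j q) a * f a) *
        (\<Sum>b\<in>comps (?N - n). shuffle_coeff (drop i p) (drop j q) b * ?K b s) =
      (if ?p i + ?q j = n then f (take i p) * f (take j q) * ?S i j else 0)" for i j
  proof (cases "?p i + ?q j = n")
    case True
    have "(\<Sum>a\<in>comps n. shuffle_coeff (take i p) (take j q) a * f a) = f (take i p) * f (take j q)"
      using f[of "take i p" "take j q"] Cons.prems composition_take_drop True by blast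
    moreover have "?N - n = sum_list (drop i p) + sum_list (drop j q)"
      using True sum_list_take_drop[of i p] sum_list_take_drop[of j q] by linarith
    moreover have "(\<Sum>b\<in>comps (sum_list (drop i p) + sum_list (drop j q)).
        shuffle_coeff (drop i p) (drop j q) b * ?K b s) = ?S i j"
      using Cons composition_take_drop by blast
    ultimately show ?thesis using True by simp
  next
    case False
    then have "(\<Sum>a\<in>comps n. shuffle_coeff (take i p) (take j q) a * f a) = 0"
      by (intro sum.neutral ballI) (simp add: comps_def shuffle_coeff_eq_0)
    then show ?thesis using False by simp
  qed
  have factor: "(if ?p i = x \<and> ?q j = n - x then f (take i p) * f (take j q) * ?S i j else 0) =
      (\<Sum>(is, js)\<in>list_splits s. (if ?p i = x then f (take i p) * ?K (drop i p) is else 0) *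
        (if ?q j = n - x then f (take j q) * ?K (drop j q) js else 0))" for i j x
    by (cases "?p i = x"; cases "?q j = n - x")
      (simp_all add: sum_distrib_left case_prod_unfold mult_ac)
  have "(\<Sum>r\<in>comps ?N. shuffle_coeff p q r * ?K r (n # s)) =
      (\<Sum>r\<in>comps ?N. \<Sum>i\<le>length r. if sum_list (take i r) = n
        then shuffle_coeff p q (take i r @ drop i r) * f (take i r) * ?K (drop i r) s else 0)"
    by (simp add: sum_distrib_left if_distrib[of "\<lambda>x. _ * x"] mult.assoc cong: if_cong)
  also have "\<dots> = (if n \<le> ?N then \<Sum>a\<in>comps n. \<Sum>b\<in>comps (?N - n).
      shuffle_coeff p q (a @ b) * f a * ?K b s else 0)"
    by (rule sum_comps_cut)
  also have "\<dots> = (if n \<le> ?N then \<Sum>i\<le>length p. \<Sum>j\<le>length q.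
      if ?p i + ?q j = n then f (take i p) * f (take j q) * ?S i j else 0 else 0)"
  proof -
    have "(\<Sum>a\<in>comps n. \<Sum>b\<in>comps (?N - n). shuffle_coeff p q (a @ b) * f a * ?K b s) =
        (\<Sum>a\<in>comps n. \<Sum>b\<in>comps (?N - n). \<Sum>i\<le>length p. \<Sum>j\<le>length q.
          (shuffle_coeff (take i p) (take j q) a * f a) * (shuffle_coeff (drop i p) (drop j q) b * ?K b s))"
      by (simp add: shuffle_coeff_append sum_distrib_left sum_distrib_right mult_ac)
    also have "\<dots> = (\<Sum>i\<le>length p. \<Sum>j\<le>length q. \<Sum>a\<in>comps n. \<Sum>b\<in>comps (?N - n).
          (shuffle_coeff (take i p) (take j q) a * f a) * (shuffle_coeff (drop i p) (drop j q) b * ?K b s))"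
      by (simp only: sum.swap[of _ "{..length q}" "comps _"] sum.swap[of _ "{..length p}" "comps _"])
    finally show ?thesis by (simp only: sum_product[symmetric] part)
  qed
  also have "\<dots> = (\<Sum>i\<le>length p. \<Sum>j\<le>length q.
      if ?p i + ?q j = n then f (take i p) * f (take j q) * ?S i j else 0)"
  proof -
    have "?p i + ?q j \<le> ?N" for i j
      using sum_list_take_drop[of i p] sum_list_take_drop[of j q] by linarith
    then have "?p i + ?q j \<noteq> n" if "\<not> n \<le> ?N" for i j
      using that by metis
    then show ?thesis by simp
  qed
  also have "\<dots> = (\<Sum>i\<le>length p. \<Sum>j\<le>length q. \<Sum>x\<le>n. if ?p i = x \<and> ?q j = n - x
      then f (take i p) * f (take j q) * ?S i j else 0)"
  proof (intro sum.cong refl)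
    fix i j
    have "(\<Sum>x\<le>n. if ?p i = x \<and> ?q j = n - x then f (take i p) * f (take j q) * ?S i j else 0) =
        (\<Sum>x\<le>n. if ?p i = x then if ?p i + ?q j = n then f (take i p) * f (take j q) * ?S i j else 0 else 0)"
      by (intro sum.cong refl) auto
    then show "(if ?p i + ?q j = n then f (take i p) * f (take j q) * ?S i j else 0) =
        (\<Sum>x\<le>n. if ?p i = x \<and> ?q j = n - x then f (take i p) * f (take j q) * ?S i j else 0)"
      by (auto simp: sum.delta')
  qed
  also have "\<dots> = (\<Sum>x\<le>n. \<Sum>i\<le>length p. \<Sum>j\<le>length q. \<Sum>(is, js)\<in>list_splits s.
      (if ?p i = x then f (take i p) * ?K (drop i p) is else 0) *
      (if ?q j = n - x then f (take j q) * ?K (drop j q) js else 0))"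
    by (simp only: sum.swap[of _ "{..n}" "{..length q}"] sum.swap[of _ "{..n}" "{..length p}"])
      (intro sum.cong refl, rule factor)
  also have "\<dots> = (\<Sum>x\<le>n. \<Sum>(is, js)\<in>list_splits s. ?K p (x # is) * ?K q ((n - x) # js))"
    by (simp only: case_prod_unfold sum.swap[of _ "list_splits s" "{..length q}"]
        sum.swap[of _ "list_splits s" "{..length p}"] sum_product[symmetric] block_coeff.simps)
  finally show ?case by (simp add: sum_list_splits_Cons)
qed

text \<open>
  For nonempty \<open>p\<close> and \<open>q\<close> this is the character property; the empty composition is the unit.
\<close>

lemma basis_value_shuffle:
  assumes G: "ab_character G" and p: "composition p" "composition q"
  shows "(\<Sum>r\<in>comps (sum_list p + sum_list q). shuffle_coeff p q r * basis_value G r) =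
    basis_value G p * basis_value G q"
proof -
  have right: "(\<Sum>r\<in>comps (sum_list p). shuffle_coeff p [] r * basis_value G r) = basis_value G p"
    if "composition p" for p
  proof -
    have "(\<Sum>r\<in>comps (sum_list p). shuffle_coeff p [] r * basis_value G r) =
        (\<Sum>r\<in>comps (sum_list p). monomial_coeff r p * basis_value G r)"
      using that by (intro sum.cong refl)
        (auto simp: comps_def shuffle_coeff_Nil_right monomial_coeff_def nonzero_parts_composition)
    then show ?thesis using that by (simp add: sum_comps_delta nonzero_parts_composition)
  qed
  consider "q = []" | "p = []" | "p \<noteq> []" "q \<noteq> []" by blast
  then show ?thesis
  proof cases
    case 1
    then show ?thesis using right p by (simp add: basis_value_def[of G "[]"])
  next
    case 2
    then show ?thesis using right[of q] p by (simp add: basis_value_def[of G "[]"] shuffle_coeff_commute[of "[]"])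
  next
    case 3
    have nonempty: "r \<noteq> []" if "r \<in> comps (sum_list p + sum_list q)" for r
      using that 3 p composition_sum_list_0[of p] by (auto simp: comps_def)
    have "G (comp_poly p) * G (comp_poly q) = G (basis_shuffle p q)"
      using 3 p by (simp add: character_shuffle[OF G, symmetric] shuffle_comp_poly)
    also have "\<dots> = (\<Sum>r\<in>comps (sum_list p + sum_list q). shuffle_coeff p q r * G (comp_poly r))"
      by (simp add: basis_shuffle_def linear_map_sum[OF linear_character[OF G]] linear_map_scale[OF linear_character[OF G]])
    also have "\<dots> = (\<Sum>r\<in>comps (sum_list p + sum_list q). shuffle_coeff p q r * basis_value G r)"
      using nonempty by (intro sum.cong refl) (simp add: basis_value_def)
    finally show ?thesis using 3 by (simp add: basis_value_def)
  qed
qed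

text \<open>
  On the basis both sides have the same coordinates by \<open>block_coeff_shuffle\<close>.
\<close>

theorem gtilde_shuffle:
  fixes G :: "'k::field ab_poly \<Rightarrow> 'k"
  assumes G: "ab_character G"
  shows "gtilde G (shuffle u v) = shuffle (gtilde G u) (gtilde G v)"
proof (rule bilinear_eq_on_comp_poly[where s = pm_scale
      and f = "\<lambda>u v. gtilde G (shuffle u v)"
      and g = "\<lambda>u v. shuffle (gtilde G u) (gtilde G v)" and u = u and v = v])
  show "plinear (\<lambda>u. gtilde G (shuffle u v))" "plinear (\<lambda>v. gtilde G (shuffle u v))"
    "plinear (\<lambda>u. shuffle (gtilde G u) (gtilde G v))" "plinear (\<lambda>v. shuffle (gtilde G u) (gtilde G v))" for u v
    using linear_compose[OF linear_shuffle_left linear_gtilde[of G]] linear_compose[OF linear_shuffle_right linear_gtilde[of G]]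
      linear_compose[OF linear_gtilde[of G] linear_shuffle_left] linear_compose[OF linear_gtilde[of G] linear_shuffle_right]
    by blast+
  fix p q assume p: "composition p" "p \<noteq> []" and q: "composition q" "q \<noteq> []"
  let ?K = "block_coeff (basis_value G)" and ?N = "sum_list p + sum_list q"
  note gt = gtilde_comp_poly[OF linear_character[OF G]]
  have nonempty: "r \<noteq> []" if "r \<in> comps n" "0 < n" for r n
    using that by (auto simp: comps_def)
  have pos: "0 < sum_list p" "0 < sum_list q"
    using p q composition_sum_list_0 by blast+
  have "gtilde G (shuffle (comp_poly p) (comp_poly q)) =
      (\<Sum>r\<in>comps ?N. pm_scale (shuffle_coeff p q r) (gtilde G (comp_poly r)))"
    using p q by (simp add: shuffle_comp_poly basis_shuffle_def linear_map_sum[OF linear_gtilde]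
        linear_map_scale[OF linear_gtilde])
  also have "\<dots> = (\<Sum>r\<in>comps ?N. \<Sum>s\<in>comps ?N. pm_scale (shuffle_coeff p q r * ?K r s) (comp_poly s))"
    using nonempty pos by (intro sum.cong refl) (auto simp: gt comps_def pm_scale_sum)
  also have "\<dots> = (\<Sum>s\<in>comps ?N. pm_scale (\<Sum>r\<in>comps ?N. shuffle_coeff p q r * ?K r s) (comp_poly s))"
    by (subst sum.swap) (simp add: pm_scale_sum_left)
  also have "\<dots> = (\<Sum>s\<in>comps ?N. pm_scale (\<Sum>t\<in>comps (sum_list p). \<Sum>t'\<in>comps (sum_list q).
      ?K p t * ?K q t' * shuffle_coeff t t' s) (comp_poly s))"
  proof (rule sum.cong[OF refl], rule arg_cong[where f = "\<lambda>a. pm_scale a _"])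
    fix s assume "s \<in> comps ?N"
    then have "(\<Sum>t\<in>comps (sum_list p). \<Sum>t'\<in>comps (sum_list q). ?K p t * ?K q t' * shuffle_coeff t t' s) =
        (\<Sum>(is, js)\<in>list_splits s. ?K p (nonzero_parts is) * ?K q (nonzero_parts js))"
      by (intro shuffle_coeff_expand) (auto simp: comps_def intro: block_coeff_eq_0)
    also have "\<dots> = (\<Sum>(is, js)\<in>list_splits s. ?K p is * ?K q js)"
      using p q by (simp add: block_coeff_nonzero_parts basis_value_def[of G "[]"])
    also have "\<dots> = (\<Sum>r\<in>comps ?N. shuffle_coeff p q r * ?K r s)"
      using block_coeff_shuffle[OF basis_value_shuffle[OF G] p(1) q(1)] by simp
    finally show "(\<Sum>r\<in>comps ?N. shuffle_coeff p q r * ?K r s) =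
        (\<Sum>t\<in>comps (sum_list p). \<Sum>t'\<in>comps (sum_list q). ?K p t * ?K q t' * shuffle_coeff t t' s)" ..
  qed
  also have "\<dots> = (\<Sum>t\<in>comps (sum_list p). \<Sum>t'\<in>comps (sum_list q).
      \<Sum>s\<in>comps ?N. pm_scale (?K p t * ?K q t' * shuffle_coeff t t' s) (comp_poly s))"
    by (simp only: pm_scale_sum_left sum.swap[of _ "comps (sum_list q)" "comps ?N"] sum.swap[of _ "comps (sum_list p)" "comps ?N"])
  also have "\<dots> = (\<Sum>t\<in>comps (sum_list p). \<Sum>t'\<in>comps (sum_list q).
      pm_scale (?K p t * ?K q t') (shuffle (comp_poly t) (comp_poly t')))"
    using nonempty pos by (intro sum.cong refl) (auto simp: comps_def shuffle_comp_poly basis_shuffle_def pm_scale_sum)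
  also have "\<dots> = shuffle (gtilde G (comp_poly p)) (gtilde G (comp_poly q))"
    unfolding gt[OF p] gt[OF q] linear_map_sum[OF linear_shuffle_left] linear_map_sum[OF linear_shuffle_right]
      linear_map_scale[OF linear_shuffle_left] linear_map_scale[OF linear_shuffle_right]
    by (simp add: pm_scale_sum mult.commute sum.swap[of _ "comps (sum_list p)" "comps (sum_list q)"])
  finally show "gtilde G (shuffle (comp_poly p) (comp_poly q)) = shuffle (gtilde G (comp_poly p)) (gtilde G (comp_poly q))" .
qed

section \<open>Monomial quasisymmetric functions\<close>

lemma mcoeff_simps [simp]:
  "mcoeff (f + g) m = mcoeff f m + mcoeff g m"
  "mcoeff (f - g) m = mcoeff f m - mcoeff g (m :: nat \<Rightarrow>\<^sub>0 nat)"
  "mcoeff (0 :: 'k::comm_ring_1 mfps) m = 0"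
  "mcoeff (mscale c h) m = c * mcoeff (h :: 'l::field mfps) m"
  by (simp_all add: plus_mfps_def minus_mfps_def zero_mfps_def mscale_def)

lemma mcoeff_one: "mcoeff (1 :: 'k::comm_ring_1 mfps) m = (if m = 0 then 1 else 0)"
  by (simp add: one_mfps_def)

lemma mcoeff_times: "mcoeff (f * g) m = (\<Sum>(i, j)\<in>splits m. mcoeff f i * mcoeff g j)"
  by (simp add: times_mfps_def)

lemma mcoeff_sum: "mcoeff (\<Sum>x\<in>A. f x) m = (\<Sum>x\<in>A. mcoeff (f x) m)"
  for f :: "'a \<Rightarrow> 'k::comm_ring_1 mfps"
  by (induction A rule: infinite_finite_induct) simp_all

lemma mscale_mult: "mscale c f * g = mscale c (f * g)" "f * mscale c g = mscale c (f * g)"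
proof -
  show "mscale c f * g = mscale c (f * g)" for f g :: "'a mfps"
    by (rule mfps_eqI) (simp add: mcoeff_times sum_distrib_left case_prod_unfold mult.assoc)
  from this[of g f] show "f * mscale c g = mscale c (f * g)"
    by (simp add: mult.commute)
qed

lemma mscale_add: "mscale c (f + g) = mscale c f + mscale c g"
  by (rule mfps_eqI) (simp add: distrib_left)

definition exponents :: "nat \<Rightarrow> (nat \<Rightarrow>\<^sub>0 nat) \<Rightarrow> nat list" where
  "exponents N m = map (Poly_Mapping.lookup m) [0..<N]"

lemma length_exponents [simp]: "length (exponents N m) = N"
  by (simp add: exponents_def)

lemma keys_bound: "\<exists>N. Poly_Mapping.keys m \<subseteq> {..<N}" for m :: "nat \<Rightarrow>\<^sub>0 nat"
  using finite_keys[of m] unfolding finite_nat_set_iff_bounded by blast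

lemma lookup_expo_notin:
  "length is = length ps \<Longrightarrow> i \<notin> set is \<Longrightarrow> Poly_Mapping.lookup (expo is ps) i = 0"
  by (induction "is" ps rule: list_induct2) (simp_all add: expo_def lookup_add lookup_single)

lemma map_lookup_expo:
  "length is = length ps \<Longrightarrow> distinct is \<Longrightarrow> map (Poly_Mapping.lookup (expo is ps)) is = ps"
proof (induction "is" ps rule: list_induct2)
  case (Cons i "is" p ps)
  have expo: "expo (i # is) (p # ps) = Poly_Mapping.single i p + expo is ps"
    by (simp add: expo_def)
  have "map (Poly_Mapping.lookup (expo (i # is) (p # ps))) is = map (Poly_Mapping.lookup (expo is ps)) is"
    using Cons.prems by (auto simp: expo lookup_add lookup_single when_def)
  also have "\<dots> = ps"
    using Cons.IH Cons.prems by simp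
  finally have "map (Poly_Mapping.lookup (expo (i # is) (p # ps))) is = ps" .
  moreover have "Poly_Mapping.lookup (expo (i # is) (p # ps)) i = p"
    using Cons.hyps Cons.prems by (simp add: expo lookup_add lookup_expo_notin)
  ultimately show ?case by simp
qed simp

lemma expo_map_lookup:
  assumes "distinct is" "Poly_Mapping.keys m \<subseteq> set is"
  shows "expo is (map (Poly_Mapping.lookup m) is) = m"
proof (rule poly_mapping_eqI)
  fix i
  have "map (Poly_Mapping.lookup (expo is (map (Poly_Mapping.lookup m) is))) is = map (Poly_Mapping.lookup m) is"
    using assms by (intro map_lookup_expo) simp_all
  moreover have "Poly_Mapping.lookup m i = 0" if "i \<notin> set is"
    using assms that by (auto simp: in_keys_iff)
  ultimately show "Poly_Mapping.lookup (expo is (map (Poly_Mapping.lookup m) is)) i = Poly_Mapping.lookup m i"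
    by (cases "i \<in> set is") (simp_all add: lookup_expo_notin)
qed

lemma exponents_expo: "exponents (length ps) (expo [0..<length ps] ps) = ps"
  unfolding exponents_def by (rule map_lookup_expo) simp_all

lemma expo_exponents: "Poly_Mapping.keys m \<subseteq> {..<N} \<Longrightarrow> expo [0..<N] (exponents N m) = m"
  unfolding exponents_def by (rule expo_map_lookup) auto

text \<open>
  The only increasing index list along which the exponents of \<open>m\<close> can form a composition.
\<close>

definition support_list :: "nat \<Rightarrow> (nat \<Rightarrow>\<^sub>0 nat) \<Rightarrow> nat list" where
  "support_list N m = filter (\<lambda>i. 0 < Poly_Mapping.lookup m i) [0..<N]"

lemma map_lookup_support_list: "map (Poly_Mapping.lookup m) (support_list N m) = nonzero_parts (exponents N m)"
  by (simp add: support_list_def exponents_def filter_map o_def)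

lemma sorted_support_list: "sorted_wrt (<) (support_list N m)"
  unfolding support_list_def by (rule sorted_wrt_filter) (rule sorted_wrt_upt)

lemma expo_support_list:
  assumes "Poly_Mapping.keys m \<subseteq> {..<N}"
  shows "expo (support_list N m) (nonzero_parts (exponents N m)) = m"
  unfolding map_lookup_support_list[symmetric]
  using assms by (intro expo_map_lookup) (auto simp: support_list_def in_keys_iff)

lemma nonzero_parts_expo:
  assumes "composition ps" "length is = length ps" "sorted_wrt (<) is" "Poly_Mapping.keys (expo is ps) \<subseteq> {..<N}"
  shows "nonzero_parts (exponents N (expo is ps)) = ps"
proof -
  let ?m = "expo is ps"
  have lookup: "map (Poly_Mapping.lookup ?m) is = ps"
    using assms by (intro map_lookup_expo) (auto simp: strict_sorted_iff)
  have pos: "0 < Poly_Mapping.lookup ?m i" if "i \<in> set is" for i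
  proof -
    have "set ps = Poly_Mapping.lookup ?m ` set is"
      using arg_cong[OF lookup, of set] by simp
    then show ?thesis using that assms(1) by (auto simp: composition_def Suc_le_eq)
  qed
  have "set (support_list N ?m) = set is"
  proof (intro set_eqI iffI)
    fix i assume "i \<in> set (support_list N ?m)"
    then have "Poly_Mapping.lookup ?m i \<noteq> 0" by (simp add: support_list_def)
    then show "i \<in> set is" using lookup_expo_notin[OF assms(2), of i] by auto
  next
    fix i assume "i \<in> set is"
    then have "i \<in> Poly_Mapping.keys ?m" using pos by (simp add: in_keys_iff)
    then show "i \<in> set (support_list N ?m)"
      using pos[OF \<open>i \<in> set is\<close>] assms(4) by (auto simp: support_list_def)
  qed
  then have "support_list N ?m = is"
    using assms(3) sorted_support_list by (metis strict_sorted_equal)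
  then show ?thesis
    using lookup by (simp add: map_lookup_support_list[symmetric])
qed

text \<open>
  All coefficients at monomials in the first \<open>N\<close> variables are read off from exponent lists of
  length \<open>N\<close>; this is how power series are reduced to lists.
\<close>

lemma mcoeff_QM:
  assumes "composition ps" and N: "Poly_Mapping.keys m \<subseteq> {..<N}"
  shows "mcoeff (QM ps) m = (monomial_coeff ps (exponents N m) :: 'k::field)"
proof -
  have "(\<exists>is. length is = length ps \<and> sorted_wrt (<) is \<and> m = expo is ps) \<longleftrightarrow> nonzero_parts (exponents N m) = ps"
  proof
    assume "\<exists>is. length is = length ps \<and> sorted_wrt (<) is \<and> m = expo is ps"
    then show "nonzero_parts (exponents N m) = ps"
      using nonzero_parts_expo assms by blast
  next
    assume "nonzero_parts (exponents N m) = ps"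
    then show "\<exists>is. length is = length ps \<and> sorted_wrt (<) is \<and> m = expo is ps"
      using expo_support_list[OF N] sorted_support_list[of N m] map_lookup_support_list[of m N]
      by (metis length_map)
  qed
  then show ?thesis by (simp add: QM_def monomial_coeff_def)
qed

lemma keys_splits:
  assumes "(i, j) \<in> splits m"
  shows "Poly_Mapping.keys i \<subseteq> Poly_Mapping.keys m" "Poly_Mapping.keys j \<subseteq> Poly_Mapping.keys m"
proof -
  have "m = i + j" using assms by (simp add: splits_def)
  then show "Poly_Mapping.keys i \<subseteq> Poly_Mapping.keys m" "Poly_Mapping.keys j \<subseteq> Poly_Mapping.keys m"
    by (auto simp: in_keys_iff lookup_add)
qed

lemma sum_splits_exponents:
  assumes N: "Poly_Mapping.keys m \<subseteq> {..<N}"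
  shows "(\<Sum>(i, j)\<in>splits m. f (exponents N i) (exponents N j)) = (\<Sum>(is, js)\<in>list_splits (exponents N m). f is js)"
proof (rule sum.reindex_bij_witness[where i = "\<lambda>(is, js). (expo [0..<N] is, expo [0..<N] js)"
      and j = "\<lambda>(i, j). (exponents N i, exponents N j)"])
  fix z assume z: "z \<in> splits m"
  obtain i j where ij: "z = (i, j)" "i + j = m" using z by (auto simp: splits_def)
  have "Poly_Mapping.keys i \<subseteq> {..<N}" "Poly_Mapping.keys j \<subseteq> {..<N}"
    using N keys_splits[of i j m] z ij by auto
  then show "(case case z of (i, j) \<Rightarrow> (exponents N i, exponents N j) of (is, js) \<Rightarrow> (expo [0..<N] is, expo [0..<N] js)) = z"
    by (simp add: ij expo_exponents)
  show "(case z of (i, j) \<Rightarrow> (exponents N i, exponents N j)) \<in> list_splits (exponents N m)"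
    unfolding ij(2)[symmetric] by (auto simp: ij(1) list_splits_def exponents_def lookup_add intro!: nth_equalityI)
  show "(case case z of (i, j) \<Rightarrow> (exponents N i, exponents N j) of (is, js) \<Rightarrow> f is js) =
      (case z of (i, j) \<Rightarrow> f (exponents N i) (exponents N j))"
    by (simp add: ij)
next
  fix z assume z: "z \<in> list_splits (exponents N m)"
  obtain a b where ab: "z = (a, b)" "length a = N" "length b = N" "map2 (+) a b = exponents N m"
    using z by (auto simp: list_splits_def)
  have exps: "exponents N (expo [0..<N] a) = a" "exponents N (expo [0..<N] b) = b"
    using exponents_expo[of a] exponents_expo[of b] ab by simp_all
  then show "(case case z of (is, js) \<Rightarrow> (expo [0..<N] is, expo [0..<N] js) of (i, j) \<Rightarrow> (exponents N i, exponents N j)) = z"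
    by (simp add: ab)
  have "Poly_Mapping.lookup (expo [0..<N] a) i + Poly_Mapping.lookup (expo [0..<N] b) i = Poly_Mapping.lookup m i" for i
  proof (cases "i < N")
    case True
    have "a ! i + b ! i = map2 (+) a b ! i" using True ab(2,3) by simp
    also have "\<dots> = Poly_Mapping.lookup m i" unfolding ab(4) using True by (simp add: exponents_def)
    finally have "a ! i + b ! i = Poly_Mapping.lookup m i" .
    moreover have "Poly_Mapping.lookup (expo [0..<N] a) i = a ! i" "Poly_Mapping.lookup (expo [0..<N] b) i = b ! i"
      using arg_cong[OF exps(1), of "\<lambda>l. l ! i"] arg_cong[OF exps(2), of "\<lambda>l. l ! i"] True
      by (simp_all add: exponents_def)
    ultimately show ?thesis by simp
  next
    case False
    then have "Poly_Mapping.lookup m i = 0" using N by (auto simp: in_keys_iff)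
    with False show ?thesis using ab by (simp add: lookup_expo_notin)
  qed
  then show "(case z of (is, js) \<Rightarrow> (expo [0..<N] is, expo [0..<N] js)) \<in> splits m"
    by (auto simp: ab(1) splits_def lookup_add intro!: poly_mapping_eqI)
qed

lemma QM_mult:
  assumes p: "composition p" and q: "composition q"
  shows "QM p * QM q =
    (\<Sum>r\<in>comps (sum_list p + sum_list q). mscale (shuffle_coeff p q r) (QM r) :: 'k::field mfps)"
proof (rule mfps_eqI)
  fix m :: "nat \<Rightarrow>\<^sub>0 nat"
  obtain N where N: "Poly_Mapping.keys m \<subseteq> {..<N}" using keys_bound by blast
  let ?e = "exponents N m"
  have "mcoeff (QM p * QM q :: 'k mfps) m =
      (\<Sum>(i, j)\<in>splits m. monomial_coeff p (exponents N i) * monomial_coeff q (exponents N j))"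
    unfolding mcoeff_times
  proof (intro sum.cong refl)
    fix z assume "z \<in> splits m"
    then obtain i j where z: "z = (i, j)" "(i, j) \<in> splits m" by (cases z) auto
    then have "Poly_Mapping.keys i \<subseteq> {..<N}" "Poly_Mapping.keys j \<subseteq> {..<N}"
      using N keys_splits by blast+
    then show "(case z of (i, j) \<Rightarrow> mcoeff (QM p :: 'k mfps) i * mcoeff (QM q) j) =
        (case z of (i, j) \<Rightarrow> monomial_coeff p (exponents N i) * monomial_coeff q (exponents N j))"
      by (simp add: z(1) mcoeff_QM p q)
  qed
  also have "\<dots> = shuffle_coeff p q ?e"
    unfolding shuffle_coeff_def by (rule sum_splits_exponents[OF N])
  also have "\<dots> = (if sum_list ?e = sum_list p + sum_list q then shuffle_coeff p q (nonzero_parts ?e) else 0)"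
    by (simp add: shuffle_coeff_nonzero_parts shuffle_coeff_eq_0)
  also have "\<dots> = (\<Sum>r\<in>comps (sum_list p + sum_list q). monomial_coeff r ?e * shuffle_coeff p q r)"
    by (rule sum_comps_delta[symmetric])
  also have "\<dots> = mcoeff (\<Sum>r\<in>comps (sum_list p + sum_list q). mscale (shuffle_coeff p q r) (QM r)) m"
    unfolding mcoeff_sum by (intro sum.cong refl) (simp add: comps_def mcoeff_QM[OF _ N] mult.commute)
  finally show "mcoeff (QM p * QM q :: 'k mfps) m =
      mcoeff (\<Sum>r\<in>comps (sum_list p + sum_list q). mscale (shuffle_coeff p q r) (QM r)) m" .
qed


section \<open>The isomorphism onto quasisymmetric functions without constant term\<close>

definition to_qsym :: "'k::field ab_poly \<Rightarrow> 'k mfps" where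
  "to_qsym u = (\<Sum>p\<in>Poly_Mapping.keys (coords u). mscale (Poly_Mapping.lookup (coords u) p) (QM p))"

lemma mcoeff_to_qsym_superset:
  assumes "finite A" "Poly_Mapping.keys (coords u) \<subseteq> A"
  shows "mcoeff (to_qsym u) m = (\<Sum>p\<in>A. Poly_Mapping.lookup (coords u) p * mcoeff (QM p) m)"
  unfolding to_qsym_def mcoeff_sum mcoeff_simps using assms
  by (intro sum.mono_neutral_left) (auto simp: in_keys_iff)

lemma linear_to_qsym: "Vector_Spaces.linear pm_scale mscale (to_qsym :: 'k::field ab_poly \<Rightarrow> _)"
  unfolding Vector_Spaces.linear_iff
proof (intro conjI allI vector_space_pm_scale vector_space_mscale)
  fix u v :: "'k ab_poly" and c :: 'k
  let ?A = "Poly_Mapping.keys (coords u) \<union> Poly_Mapping.keys (coords v)"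
  have "Poly_Mapping.keys (coords (u + v)) \<subseteq> ?A"
    unfolding linear_map_add[OF linear_coords] by (rule Poly_Mapping.keys_add)
  then show "to_qsym (u + v) = to_qsym u + to_qsym v"
    by (intro mfps_eqI) (simp add: mcoeff_to_qsym_superset[of ?A] linear_map_add[OF linear_coords]
        lookup_add distrib_right sum.distrib)
  have "Poly_Mapping.keys (coords (pm_scale c u)) \<subseteq> Poly_Mapping.keys (coords u)"
    by (auto simp: linear_map_scale[OF linear_coords] in_keys_iff)
  then show "to_qsym (pm_scale c u) = mscale c (to_qsym u)"
    by (intro mfps_eqI) (simp add: mcoeff_to_qsym_superset[of "Poly_Mapping.keys (coords u)"]
        linear_map_scale[OF linear_coords] sum_distrib_left mult.assoc)
qed

lemma to_qsym_comp_poly: "composition p \<Longrightarrow> p \<noteq> [] \<Longrightarrow> to_qsym (comp_poly p) = (QM p :: 'k::field mfps)"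
  by (rule mfps_eqI) (simp add: to_qsym_def coords_comp_poly)

lemma gam_eq_to_qsym: "gam = (to_qsym :: 'k::field ab_poly \<Rightarrow> _)"
  unfolding gam_def
proof (rule the_equality)
  fix \<gamma> :: "'k ab_poly \<Rightarrow> 'k mfps"
  assume \<gamma>: "Vector_Spaces.linear pm_scale mscale \<gamma> \<and>
    (\<forall>ps. ps \<noteq> [] \<longrightarrow> composition ps \<longrightarrow> \<gamma> (comp_poly ps) = QM ps)"
  show "\<gamma> = to_qsym"
    by (rule ext, rule linear_eq_on_comp_poly[where s = mscale]) (use \<gamma> in \<open>simp_all add: linear_to_qsym to_qsym_comp_poly\<close>)
qed (simp add: linear_to_qsym to_qsym_comp_poly)

lemma linear_gam: "Vector_Spaces.linear pm_scale mscale gam"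
  by (simp add: gam_eq_to_qsym linear_to_qsym)

lemma gam_comp_poly: "composition p \<Longrightarrow> p \<noteq> [] \<Longrightarrow> gam (comp_poly p) = QM p"
  by (simp add: gam_eq_to_qsym to_qsym_comp_poly)

text \<open>
  The monomial with exponents \<open>p\<close> in the first variables occurs in \<open>QM p\<close> only, so coordinates can
  be recovered from the image.
\<close>

lemma mcoeff_gam_expo:
  fixes u :: "'k::field ab_poly"
  assumes "composition p"
  shows "mcoeff (gam u) (expo [0..<length p] p) = Poly_Mapping.lookup (coords u) p"
proof -
  let ?m = "expo [0..<length p] p"
  have "Poly_Mapping.keys ?m \<subseteq> {..<length p}"
    using lookup_expo_notin[of "[0..<length p]" p] by (force simp: in_keys_iff)
  then have "mcoeff (QM q :: 'k mfps) ?m = (if q = p then 1 else 0)" if "composition q" for q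
    using that by (simp add: mcoeff_QM exponents_expo monomial_coeff_def nonzero_parts_composition assms)
  then have "mcoeff (gam u) ?m =
      (\<Sum>q\<in>Poly_Mapping.keys (coords u). Poly_Mapping.lookup (coords u) q * (if q = p then 1 else 0))"
    unfolding gam_eq_to_qsym to_qsym_def mcoeff_sum mcoeff_simps
    by (intro sum.cong refl) (simp add: coords_keys)
  also have "\<dots> = Poly_Mapping.lookup (coords u) p"
    by (simp add: if_distrib[of "\<lambda>x. _ * x"] sum.delta in_keys_iff cong: if_cong)
  finally show ?thesis .
qed

lemma inj_gam: "inj gam"
proof (rule injI)
  fix u v :: "'k::field ab_poly" assume "gam u = gam v"
  have "coords u = coords v"
  proof (rule poly_mapping_eqI)
    fix p
    show "Poly_Mapping.lookup (coords u) p = Poly_Mapping.lookup (coords v) p"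
    proof (cases "composition p")
      case True
      then show ?thesis using \<open>gam u = gam v\<close> by (simp add: mcoeff_gam_expo[symmetric])
    next
      case False
      then show ?thesis using coords_keys by (metis in_keys_iff)
    qed
  qed
  then show "u = v" by (metis comp_poly_coords)
qed

lemma constant_term_gam: "mcoeff (gam u) 0 = (0 :: 'k::field)"
proof -
  have "mcoeff (gam u) (expo [] []) = Poly_Mapping.lookup (coords u) []"
    using mcoeff_gam_expo[of "[]" u] by simp
  then show ?thesis using coords_keys[of "[]" u] by (auto simp: expo_def in_keys_iff)
qed

theorem gam_shuffle: "gam (shuffle u v) = gam u * (gam v :: 'k::field mfps)"
proof (rule bilinear_eq_on_comp_poly[where s = mscale and f = "\<lambda>u v. gam (shuffle u v)"
      and g = "\<lambda>u v. gam u * gam v" and u = u and v = v])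
  show "Vector_Spaces.linear pm_scale mscale (\<lambda>u. gam (shuffle u v))"
    "Vector_Spaces.linear pm_scale mscale (\<lambda>v. gam (shuffle u v))" for u v :: "'k ab_poly"
    using linear_compose[OF linear_shuffle_left linear_gam] linear_compose[OF linear_shuffle_right linear_gam] by blast+
  show "Vector_Spaces.linear pm_scale mscale (\<lambda>u. gam u * gam v)"
    "Vector_Spaces.linear pm_scale mscale (\<lambda>v. gam u * gam v)" for u v :: "'k ab_poly"
    unfolding Vector_Spaces.linear_iff
    by (simp_all add: vector_space_pm_scale vector_space_mscale linear_map_add[OF linear_gam]
        linear_map_scale[OF linear_gam] mscale_mult distrib_left distrib_right)
  fix p q assume p: "composition p" "p \<noteq> []" and q: "composition q" "q \<noteq> []"
  have nonempty: "r \<noteq> []" if "r \<in> comps (sum_list p + sum_list q)" for r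
    using that p composition_sum_list_0[of p] by (auto simp: comps_def)
  then show "gam (shuffle (comp_poly p) (comp_poly q)) = gam (comp_poly p) * (gam (comp_poly q) :: 'k mfps)"
    using p q by (simp add: shuffle_comp_poly basis_shuffle_def gam_comp_poly QM_mult
        linear_map_sum[OF linear_gam] linear_map_scale[OF linear_gam] comps_def)
qed

text \<open>
  A quasisymmetric function of degree at most \<open>d\<close> is the combination of the \<open>QM p\<close> with
  \<open>sum_list p \<le> d\<close> whose coefficients are its own coefficients at the initial monomials.
\<close>

lemma QSym_decompose:
  fixes f :: "'k::field mfps"
  assumes "f \<in> QSym"
  shows "\<exists>u. f = mscale (mcoeff f 0) 1 + gam u"
proof -
  obtain d where d: "\<And>m. mcoeff f m \<noteq> 0 \<Longrightarrow> (\<Sum>i\<in>Poly_Mapping.keys m. Poly_Mapping.lookup m i) \<le> d"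
    using assms unfolding QSym_def by blast
  have quasi: "mcoeff f (expo is ps) = mcoeff f (expo js ps)"
    if "composition ps" "length is = length ps" "length js = length ps" "sorted_wrt (<) is" "sorted_wrt (<) js" for ps "is" js
    using assms that unfolding QSym_def by blast
  let ?A = "(\<Union>n\<in>{1..d}. comps n)"
  let ?c = "\<lambda>p. mcoeff f (expo [0..<length p] p)"
  have A: "p \<in> ?A \<longleftrightarrow> composition p \<and> p \<noteq> [] \<and> sum_list p \<le> d" for p
  proof -
    have "1 \<le> sum_list p \<longleftrightarrow> p \<noteq> []" if "composition p"
      using that by (cases p) auto
    moreover have "p \<in> ?A \<longleftrightarrow> composition p \<and> 1 \<le> sum_list p \<and> sum_list p \<le> d"
      by (auto simp: comps_def)
    ultimately show ?thesis by blast
  qed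
  define u where "u = (\<Sum>p\<in>?A. pm_scale (?c p) (comp_poly p))"
  have gam_u: "gam u = (\<Sum>p\<in>?A. mscale (?c p) (QM p))"
    unfolding u_def linear_map_sum[OF linear_gam] linear_map_scale[OF linear_gam]
    by (intro sum.cong refl) (use A in \<open>simp add: gam_comp_poly\<close>)
  have "mcoeff f m = mcoeff (mscale (mcoeff f 0) 1 + gam u) m" for m :: "nat \<Rightarrow>\<^sub>0 nat"
  proof -
    obtain N where N: "Poly_Mapping.keys m \<subseteq> {..<N}" using keys_bound by blast
    let ?p = "nonzero_parts (exponents N m)"
    have "mcoeff (gam u) m = (\<Sum>p\<in>?A. if p = ?p then ?c p else 0)"
      unfolding gam_u mcoeff_sum mcoeff_simps
      by (intro sum.cong refl) (auto simp: mcoeff_QM[OF _ N] monomial_coeff_def comps_def)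
    also have "\<dots> = (if ?p \<in> ?A then ?c ?p else 0)"
      by (subst sum.delta) simp_all
    also have "?c ?p = mcoeff f m"
    proof -
      have "length (support_list N m) = length ?p"
        by (metis length_map map_lookup_support_list)
      then have "?c ?p = mcoeff f (expo (support_list N m) ?p)"
        by (intro quasi) (simp_all add: sorted_support_list sorted_wrt_upt)
      then show ?thesis by (simp add: expo_support_list[OF N])
    qed
    finally have gam: "mcoeff (gam u) m = (if ?p \<in> ?A then mcoeff f m else 0)" .
    have "?p = [] \<longleftrightarrow> m = 0"
      using expo_support_list[OF N] by (auto simp: expo_def exponents_def)
    moreover have "mcoeff f m = 0" if "d < sum_list ?p"
    proof -
      have "sum_list ?p = (\<Sum>i<N. Poly_Mapping.lookup m i)"
        by (simp add: exponents_def interv_sum_list_conv_sum_set_nat atLeast0LessThan)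
      also have "\<dots> = (\<Sum>i\<in>Poly_Mapping.keys m. Poly_Mapping.lookup m i)"
        using N by (intro sum.mono_neutral_right) (auto simp: in_keys_iff)
      finally show ?thesis using that d[of m] by fastforce
    qed
    ultimately show ?thesis
      using gam A[of ?p] by (cases "m = 0") (auto simp: mcoeff_one)
  qed
  then show ?thesis by (blast intro: mfps_eqI)
qed

lemma gtilde_QSym_eq:
  "gtilde_QSym G (mscale c 1 + gam u) = mscale c 1 + gam (gtilde G u)"
  by (simp add: gtilde_QSym_def mcoeff_one constant_term_gam inv_f_f[OF inj_gam])

theorem theorem12p5:
  fixes G :: "'k::field ab_poly \<Rightarrow> 'k"
  assumes "ab_character G"
  shows "(\<forall>u v. gtilde G (mix u v) = mix (gtilde G u) (gtilde G v))
       \<and> (\<forall>f1\<in>QSym. \<forall>f2\<in>QSym. gtilde_QSym G (f1 * f2) = gtilde_QSym G f1 * gtilde_QSym G f2)"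
proof (intro conjI allI ballI)
  fix u v
  show "gtilde G (mix u v) = mix (gtilde G u) (gtilde G v)"
    unfolding mix_eq_shuffle by (rule gtilde_shuffle[OF assms])
next
  fix f1 f2 :: "'k mfps" assume "f1 \<in> QSym" "f2 \<in> QSym"
  then obtain c1 u1 c2 u2 where f: "f1 = mscale c1 1 + gam u1" "f2 = mscale c2 1 + gam u2"
    using QSym_decompose by metis
  have expand: "(mscale c1 1 + gam v1) * (mscale c2 1 + gam v2) =
      mscale (c1 * c2) 1 + gam (pm_scale c1 v2 + pm_scale c2 v1 + shuffle v1 v2)" for v1 v2 :: "'k ab_poly"
  proof -
    have "mscale c2 (mscale c1 1) = mscale (c1 * c2) (1 :: 'k mfps)"
      by (rule mfps_eqI) simp
    then show ?thesis
      by (simp add: linear_map_add[OF linear_gam] linear_map_scale[OF linear_gam] gam_shuffle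
          distrib_left distrib_right mscale_mult mscale_add add_ac)
  qed
  show "gtilde_QSym G (f1 * f2) = gtilde_QSym G f1 * gtilde_QSym G f2"
    unfolding f expand gtilde_QSym_eq
    by (simp add: linear_map_add[OF linear_gtilde] linear_map_scale[OF linear_gtilde] gtilde_shuffle[OF assms])
qed

end
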